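(* Let $R=\bigoplus_{n\ge 0}R_n$ be a standard graded Noetherian algebra over an infinite field $K$, let $M$ be a finitely generated nonzero $\mathbb{Z}$-graded $R$-module, and let $I$ be a graded ideal of $R$. Then there exist integers $\epsilon_1\ge \epsilon_2\ge d(M)$ such that $$r(I^nM)=\rho_I(M)\,n+\epsilon_1\quad\text{and}\quad D(I^nM)=\rho_I(M)\,n+\epsilon_2\qquad\text{for } n\gg 0.$$
   Context: "Standard graded" means that $R_0=K$ and $R=K[R_1]$; $R_+=\bigoplus_{n>0}R_n$. A linear form of $R$ is a nonzero element of $R_1$. For a finitely generated nonzero $\mathbb{Z}$-graded $R$-module $N$: - $D(N):=\max\{n\in\mathbb{Z}: (N/R_+N)_n\ne 0\}$ and $d(N):=\min\{n\in\mathbb{Z}: N_n\neq 0\}$, the largest and least degrees of a minimal system of generators of $N$. - A graded ideal $J$ of $R$ is called an $N$-reduction if $J$ is generated by linear forms and $(JN)_n=N_n$ for $n\gg0$. An $N$-reduction is called minimal if it does not contain any other $N$-reduction. - The reduction number of $N$ with respect to an $N$-reduction $J$ is $r_J(N):=\max\{n\in\mathbb{Z}: (JN)_n\ne N_n\}$, and the reduction number of $N$ is $r(N):=\min\{r_J(N): J \text{ is a minimal } N\text{-reduction}\}$. A different notion: a graded ideal $J$ contained in $I$ is an $M$-reduction of $I$ if $JI^nM=I^{n+1}M$ for some $n>0$ (here $J$ is not required to be generated by linear forms). The integer $\rho_I(M)$ is defined by $\rho_I(M):=\min\{D(J): J\text{ is an } M\text{-reduction of } I\}$, where $D(J)$ is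 the largest degree of a minimal generator of $J$. *)

theory Defs
  imports Complex_Main
begin

section \<open>Rings and modules\<close>

text \<open>
  Rings are types of class \<^class>\<open>comm_ring_1\<close>; a module over such a ring is a type together
  with a scalar multiplication satisfying the library locale \<^locale>\<open>module\<close>.
  A ring is a module over itself via multiplication, so an ideal is a submodule in this sense.
\<close>

abbreviation is_ideal :: "'a::comm_ring_1 set \<Rightarrow> bool" where
  "is_ideal J \<equiv> module.subspace (*) J"

abbreviation ideal_span :: "'a::comm_ring_1 set \<Rightarrow> 'a set" where
  "ideal_span S \<equiv> module.span (*) S"

definition is_subring :: "'a::comm_ring_1 set \<Rightarrow> bool" where
  "is_subring S \<longleftrightarrow> 1 \<in> S \<and> (\<forall>x\<in>S. \<forall>y\<in>S. x - y \<in> S \<and> x * y \<in> S)"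

definition is_subfield :: "'a::comm_ring_1 set \<Rightarrow> bool" where
  "is_subfield K \<longleftrightarrow> is_subring K \<and> (\<forall>x\<in>K. x \<noteq> 0 \<longrightarrow> (\<exists>y\<in>K. x * y = 1))"

definition ideal_module_prod ::
    "('a::comm_ring_1 \<Rightarrow> 'm::ab_group_add \<Rightarrow> 'm) \<Rightarrow> 'a set \<Rightarrow> 'm set \<Rightarrow> 'm set" where
  "ideal_module_prod scale J N = module.span scale {scale a x | a x. a \<in> J \<and> x \<in> N}"

primrec ideal_power :: "'a::comm_ring_1 set \<Rightarrow> nat \<Rightarrow> 'a set" where
  "ideal_power I 0 = UNIV"
| "ideal_power I (Suc n) = ideal_module_prod (*) I (ideal_power I n)"

section \<open>Gradings\<close>

definition finite_sums :: "'i set \<Rightarrow> ('i \<Rightarrow> 'm::ab_group_add set) \<Rightarrow> 'm set" where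
  "finite_sums A G = {\<Sum>i\<in>F. f i | F f. finite F \<and> F \<subseteq> A \<and> (\<forall>i\<in>F. f i \<in> G i)}"

text \<open>The whole type is the internal direct sum of the additive subgroups \<open>G i\<close>.\<close>

definition is_direct_sum :: "('i \<Rightarrow> 'm::ab_group_add set) \<Rightarrow> bool" where
  "is_direct_sum G \<longleftrightarrow>
     (\<forall>i. 0 \<in> G i \<and> (\<forall>x\<in>G i. \<forall>y\<in>G i. x - y \<in> G i)) \<and>
     (\<forall>x. \<exists>!f. (\<forall>i. f i \<in> G i) \<and> finite {i. f i \<noteq> 0} \<and> x = (\<Sum>i | f i \<noteq> 0. f i))"

locale standard_graded_algebra =
  fixes K :: "'a::comm_ring_1 set" and R :: "nat \<Rightarrow> 'a set"
  assumes field: "is_subfield K"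
    and direct_sum: "is_direct_sum R"
    and mult_closed: "x \<in> R i \<Longrightarrow> y \<in> R j \<Longrightarrow> x * y \<in> R (i + j)"
    and degree_zero: "R 0 = K"
    and generated_in_degree_one: "is_subring hull (K \<union> R 1) = UNIV"

locale graded_module = module scale
  for scale :: "'a::comm_ring_1 \<Rightarrow> 'm::ab_group_add \<Rightarrow> 'm" +
  fixes R :: "nat \<Rightarrow> 'a set" and M :: "int \<Rightarrow> 'm set"
  assumes direct_sum: "is_direct_sum M"
    and scale_closed: "a \<in> R i \<Longrightarrow> x \<in> M j \<Longrightarrow> scale a x \<in> M (int i + j)"

definition graded_submodule ::
    "('a::comm_ring_1 \<Rightarrow> 'm::ab_group_add \<Rightarrow> 'm) \<Rightarrow> (int \<Rightarrow> 'm set) \<Rightarrow> 'm set \<Rightarrow> bool" where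
  "graded_submodule scale M N \<longleftrightarrow>
     module.subspace scale N \<and> N \<subseteq> finite_sums UNIV (\<lambda>n. N \<inter> M n)"

definition int_grading :: "(nat \<Rightarrow> 'a::comm_ring_1 set) \<Rightarrow> int \<Rightarrow> 'a set" where
  "int_grading R n = (if n < 0 then {0} else R (nat n))"

abbreviation graded_ideal :: "(nat \<Rightarrow> 'a::comm_ring_1 set) \<Rightarrow> 'a set \<Rightarrow> bool" where
  "graded_ideal R J \<equiv> graded_submodule (*) (int_grading R) J"

definition irrelevant_ideal :: "(nat \<Rightarrow> 'a::comm_ring_1 set) \<Rightarrow> 'a set" where
  "irrelevant_ideal R = finite_sums {n. n > 0} R"

section \<open>Degrees of generators and reduction numbers\<close>

text \<open>
  Below, \<open>N\<close> is a graded submodule of a module graded by \<open>M\<close>, and the degree \<open>n\<close> part of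
  \<open>N\<close> is \<open>N \<inter> M n\<close>. The degree \<open>n\<close> part of \<open>N / R\<^sub>+N\<close> is the image of \<open>N \<inter> M n\<close>,
  hence nonzero iff \<open>N \<inter> M n\<close> is not contained in \<open>R\<^sub>+N\<close>. The maxima and minima are
  unspecified when they do not exist, in particular for \<open>N = 0\<close>.
\<close>

definition max_gen_degree ::
    "('a::comm_ring_1 \<Rightarrow> 'm::ab_group_add \<Rightarrow> 'm) \<Rightarrow> (nat \<Rightarrow> 'a set) \<Rightarrow> (int \<Rightarrow> 'm set)
      \<Rightarrow> 'm set \<Rightarrow> int" where
  "max_gen_degree scale R M N =
     (GREATEST n. \<not> N \<inter> M n \<subseteq> ideal_module_prod scale (irrelevant_ideal R) N)"

definition min_degree :: "(int \<Rightarrow> 'm::ab_group_add set) \<Rightarrow> 'm set \<Rightarrow> int" where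
  "min_degree M N = (LEAST n. N \<inter> M n \<noteq> {0})"

text \<open>The set \<open>L\<close> of linear forms may be empty, so \<open>J\<close> may be the zero ideal.\<close>

definition linear_reduction ::
    "('a::comm_ring_1 \<Rightarrow> 'm::ab_group_add \<Rightarrow> 'm) \<Rightarrow> (nat \<Rightarrow> 'a set) \<Rightarrow> (int \<Rightarrow> 'm set)
      \<Rightarrow> 'm set \<Rightarrow> 'a set \<Rightarrow> bool" where
  "linear_reduction scale R M N J \<longleftrightarrow>
     graded_ideal R J \<and>
     (\<exists>L \<subseteq> R 1 - {0}. J = ideal_span L) \<and>
     (\<forall>\<^sub>F n in at_top. ideal_module_prod scale J N \<inter> M n = N \<inter> M n)"

definition minimal_linear_reduction ::
    "('a::comm_ring_1 \<Rightarrow> 'm::ab_group_add \<Rightarrow> 'm) \<Rightarrow> (nat \<Rightarrow> 'a set) \<Rightarrow> (int \<Rightarrow> 'm set)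
      \<Rightarrow> 'm set \<Rightarrow> 'a set \<Rightarrow> bool" where
  "minimal_linear_reduction scale R M N J \<longleftrightarrow>
     linear_reduction scale R M N J \<and>
     (\<forall>J'. linear_reduction scale R M N J' \<and> J' \<subseteq> J \<longrightarrow> J' = J)"

definition reduction_number_wrt ::
    "('a::comm_ring_1 \<Rightarrow> 'm::ab_group_add \<Rightarrow> 'm) \<Rightarrow> (int \<Rightarrow> 'm set)
      \<Rightarrow> 'm set \<Rightarrow> 'a set \<Rightarrow> int" where
  "reduction_number_wrt scale M N J =
     (GREATEST n. ideal_module_prod scale J N \<inter> M n \<noteq> N \<inter> M n)"

definition reduction_number ::
    "('a::comm_ring_1 \<Rightarrow> 'm::ab_group_add \<Rightarrow> 'm) \<Rightarrow> (nat \<Rightarrow> 'a set) \<Rightarrow> (int \<Rightarrow> 'm set)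
      \<Rightarrow> 'm set \<Rightarrow> int" where
  "reduction_number scale R M N =
     (LEAST r. \<exists>J. minimal_linear_reduction scale R M N J \<and> r = reduction_number_wrt scale M N J)"

text \<open>Reductions of an ideal \<open>I\<close> with respect to the whole module (the type \<open>'m\<close>).\<close>

definition reduction_of_ideal ::
    "('a::comm_ring_1 \<Rightarrow> 'm::ab_group_add \<Rightarrow> 'm) \<Rightarrow> (nat \<Rightarrow> 'a set)
      \<Rightarrow> 'a set \<Rightarrow> 'a set \<Rightarrow> bool" where
  "reduction_of_ideal scale R I J \<longleftrightarrow>
     graded_ideal R J \<and> J \<subseteq> I \<and>
     (\<exists>n>0. ideal_module_prod scale J (ideal_module_prod scale (ideal_power I n) UNIV)
             = ideal_module_prod scale (ideal_power I (n + 1)) UNIV)"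

definition rho ::
    "('a::comm_ring_1 \<Rightarrow> 'm::ab_group_add \<Rightarrow> 'm) \<Rightarrow> (nat \<Rightarrow> 'a set) \<Rightarrow> 'a set \<Rightarrow> int" where
  "rho scale R I =
     (LEAST d. \<exists>J. reduction_of_ideal scale R I J \<and> d = max_gen_degree (*) R (int_grading R) J)"

end

theory Submission
  imports Defs
begin

text \<open>
  Put \<open>N\<^sub>n = I\<^sup>nM\<close> and \<open>\<rho> = \<rho>\<^sub>I(M)\<close>, and let \<open>J\<^sub>0\<close> be a reduction of \<open>I\<close> generated in
  degrees at most \<open>\<rho>\<close>. For large \<open>n\<close> the equality \<open>N\<^sub>n\<^sub>+\<^sub>1 = J\<^sub>0N\<^sub>n\<close> shows
  that \<open>D(N\<^sub>n\<^sub>+\<^sub>1) \<le> D(N\<^sub>n) + \<rho>\<close> and, for every \<open>N\<^sub>n\<close>-reduction \<open>J\<close>, that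
  \<open>r\<^sub>J(N\<^sub>n\<^sub>+\<^sub>1) \<le> r\<^sub>J(N\<^sub>n) + \<rho>\<close>. The minimal \<open>N\<^sub>n\<close>-reductions do not depend on \<open>n\<close> for large \<open>n\<close>,
  because the annihilators of the \<open>N\<^sub>n\<close> form an ascending chain. Hence \<open>D(N\<^sub>n) - \<rho>n\<close> and
  \<open>r(N\<^sub>n) - \<rho>n\<close> are eventually nonincreasing. Both are bounded below by \<open>d(M)\<close>: otherwise each
  homogeneous generator of \<open>N\<^sub>n\<close> would be a sum of products with a factor in \<open>I\<close> of degree less
  than \<open>\<rho>\<close>, and the elements of \<open>I\<close> of degree less than \<open>\<rho>\<close> would generate a reduction of \<open>I\<close>.
  Integer sequences that are nonincreasing and bounded below are eventually constant.
\<close>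

section \<open>Integer extrema\<close>

text \<open>A set of integers that contains \<open>a\<close> and is bounded above by
  \<open>b\<close> is finite from \<open>a\<close> onwards, so a maximum exists.
  \<open>GREATEST\<close> is unspecified without one; the degrees \<open>D(N)\<close> and
  \<open>r_J(N)\<close> acquire their meaning through this lemma.\<close>

lemma int_Greatest:
  fixes P :: "int \<Rightarrow> bool"
  assumes "P a" "\<And>y. P y \<Longrightarrow> y \<le> b"
  shows "P (Greatest P)" "\<And>y. P y \<Longrightarrow> y \<le> Greatest P"
proof -
  let ?A = "{y. P y \<and> a \<le> y}"
  have "finite ?A"
    by (rule finite_subset[of _ "{a..b}"]) (use assms in auto)
  moreover have "a \<in> ?A"
    using assms(1) by simp
  ultimately have mem: "Max ?A \<in> ?A" and ge: "\<And>y. y \<in> ?A \<Longrightarrow> y \<le> Max ?A"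
    using Max_in[of ?A] Max_ge[of ?A] by blast+
  have upper: "y \<le> Max ?A" if "P y" for y
    using ge[of y] ge[of a] assms(1) that by force
  have "Greatest P = Max ?A"
    using mem upper by (intro Greatest_equality) auto
  then show "P (Greatest P)" "\<And>y. P y \<Longrightarrow> y \<le> Greatest P"
    using mem upper by auto
qed

lemma int_Least:
  fixes P :: "int \<Rightarrow> bool"
  assumes "P a" "\<And>y. P y \<Longrightarrow> b \<le> y"
  shows "P (Least P)" "\<And>y. P y \<Longrightarrow> Least P \<le> y"
proof -
  let ?A = "{y. P y \<and> y \<le> a}"
  have "finite ?A"
    by (rule finite_subset[of _ "{b..a}"]) (use assms in auto)
  moreover have "a \<in> ?A"
    using assms(1) by simp
  ultimately have mem: "Min ?A \<in> ?A" and le: "\<And>y. y \<in> ?A \<Longrightarrow> Min ?A \<le> y"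
    using Min_in[of ?A] Min_le[of ?A] by blast+
  have lower: "Min ?A \<le> y" if "P y" for y
    using le[of y] le[of a] assms(1) that by force
  have "Least P = Min ?A"
    using mem lower by (intro Least_equality) auto
  then show "P (Least P)" "\<And>y. P y \<Longrightarrow> Least P \<le> y"
    using mem lower by auto
qed

text \<open>The least value is attained at some \<open>n0\<close>; from there on the sequence can
  neither rise nor fall.\<close>

lemma antimono_int_eventually_constant:
  fixes f :: "nat \<Rightarrow> int"
  assumes "\<And>n. n \<ge> m \<Longrightarrow> f (Suc n) \<le> f n" "\<And>n. n \<ge> m \<Longrightarrow> c \<le> f n"
  obtains l n0 where "\<And>n. n \<ge> n0 \<Longrightarrow> f n = l" "n0 \<ge> m"
proof -
  let ?P = "\<lambda>y. \<exists>n\<ge>m. f n = y"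
  have L: "?P (Least ?P)" "\<And>y. ?P y \<Longrightarrow> Least ?P \<le> y"
    using int_Least[of ?P "f m" c] assms(2) by auto
  then obtain n0 where n0: "n0 \<ge> m" "f n0 = Least ?P"
    by blast
  have "f n \<le> f n0" if "n \<ge> n0" for n
    using that
  proof (induct n rule: dec_induct)
    case (step k)
    then show ?case
      using assms(1)[of k] n0(1) by simp
  qed simp
  moreover have "Least ?P \<le> f n" if "n \<ge> n0" for n
    using L(2)[of "f n"] that n0(1) order_trans by blast
  ultimately show ?thesis
    using n0 that[of n0 "Least ?P"] by (metis order_antisym)
qed

section \<open>Homogeneous components\<close>

definition component :: "('i \<Rightarrow> 'm::ab_group_add set) \<Rightarrow> 'm \<Rightarrow> 'i \<Rightarrow> 'm" where
  "component G x = (THE f. (\<forall>i. f i \<in> G i) \<and> finite {i. f i \<noteq> 0} \<and> x = (\<Sum>i | f i \<noteq> 0. f i))"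

context
  fixes G :: "'i \<Rightarrow> 'm::ab_group_add set"
  assumes direct: "is_direct_sum G"
begin

lemma direct_sum_zero: "0 \<in> G i"
  using direct by (auto simp: is_direct_sum_def)

lemma direct_sum_diff: "x \<in> G i \<Longrightarrow> y \<in> G i \<Longrightarrow> x - y \<in> G i"
  using direct by (auto simp: is_direct_sum_def)

lemma direct_sum_add: "x \<in> G i \<Longrightarrow> y \<in> G i \<Longrightarrow> x + y \<in> G i"
  using direct_sum_diff[of x i "0 - y"] direct_sum_diff[OF direct_sum_zero, of y i] by simp

lemma component_props:
  "(\<forall>i. component G x i \<in> G i) \<and> finite {i. component G x i \<noteq> 0} \<and>
    x = (\<Sum>i | component G x i \<noteq> 0. component G x i)"
proof -
  have "\<exists>!f. (\<forall>i. f i \<in> G i) \<and> finite {i. f i \<noteq> 0} \<and> x = (\<Sum>i | f i \<noteq> 0. f i)"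
    using direct by (auto simp: is_direct_sum_def)
  from theI'[OF this] show ?thesis
    unfolding component_def .
qed

lemma component_mem: "component G x i \<in> G i"
  and finite_support_component: "finite {i. component G x i \<noteq> 0}"
  and sum_component: "(\<Sum>i | component G x i \<noteq> 0. component G x i) = x"
  using component_props[of x] by auto

text \<open>The tool for computing components: exhibit one decomposition. \<open>A\<close> may
  exceed the support, so terms of the decomposition are allowed to vanish.\<close>

lemma component_unique:
  assumes "\<And>i. f i \<in> G i" "finite A" "\<And>i. i \<notin> A \<Longrightarrow> f i = 0" "x = sum f A"
  shows "component G x = f"
proof -
  have "\<exists>!f. (\<forall>i. f i \<in> G i) \<and> finite {i. f i \<noteq> 0} \<and> x = (\<Sum>i | f i \<noteq> 0. f i)"
    using direct by (auto simp: is_direct_sum_def)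
  moreover have "{i. f i \<noteq> 0} \<subseteq> A"
    using assms(3) by auto
  moreover from this have "finite {i. f i \<noteq> 0}"
    using assms(2) by (rule finite_subset)
  moreover have "x = (\<Sum>i | f i \<noteq> 0. f i)"
    unfolding assms(4) using \<open>{i. f i \<noteq> 0} \<subseteq> A\<close> assms(2)
    by (intro sum.mono_neutral_right) auto
  ultimately show ?thesis
    using component_props[of x] assms(1) by blast
qed

lemma sum_component_superset:
  assumes "finite A" "{i. component G x i \<noteq> 0} \<subseteq> A"
  shows "sum (component G x) A = x"
proof -
  have "sum (component G x) A = sum (component G x) {i. component G x i \<noteq> 0}"
    using assms by (intro sum.mono_neutral_right) auto
  then show ?thesis
    using sum_component by simp
qed

lemma component_homogeneous: "x \<in> G j \<Longrightarrow> component G x = (\<lambda>i. if i = j then x else 0)"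
  by (rule component_unique[where A = "{j}"]) (auto simp: direct_sum_zero)

lemma component_zero: "component G 0 i = 0"
  using component_homogeneous[OF direct_sum_zero] by simp

lemma component_add: "component G (x + y) i = component G x i + component G y i"
proof -
  let ?A = "{i. component G x i \<noteq> 0} \<union> {i. component G y i \<noteq> 0}"
  have "component G (x + y) = (\<lambda>i. component G x i + component G y i)"
    by (rule component_unique[where A = ?A])
      (auto simp: sum.distrib sum_component_superset finite_support_component
        intro: direct_sum_add component_mem)
  then show ?thesis by simp
qed

lemma direct_sum_disjoint: "x \<in> G i \<Longrightarrow> x \<in> G j \<Longrightarrow> i \<noteq> j \<Longrightarrow> x = 0"
  using component_homogeneous[of x i] component_homogeneous[of x j] by metis

end

section \<open>The ring as an integer-graded module over itself\<close>

context standard_graded_algebra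
begin

text \<open>A family in \<open>int_grading R\<close> vanishes at negative indices, so its support is
  the image under \<open>int\<close> of a support for \<open>R\<close>; existence and uniqueness
  carry over.\<close>

lemma is_direct_sum_int_grading: "is_direct_sum (int_grading R)"
  unfolding is_direct_sum_def
proof (intro conjI allI)
  fix i show "0 \<in> int_grading R i"
    by (auto simp: int_grading_def direct_sum_zero[OF direct_sum])
  show "\<forall>x\<in>int_grading R i. \<forall>y\<in>int_grading R i. x - y \<in> int_grading R i"
    by (auto simp: int_grading_def direct_sum_diff[OF direct_sum])
next
  fix x :: 'a
  let ?P = "\<lambda>f. (\<forall>i. f i \<in> int_grading R i) \<and> finite {i. f i \<noteq> 0} \<and> x = (\<Sum>i | f i \<noteq> 0. f i)"
  define g where "g i = (if i < 0 then 0 else component R x (nat i))" for i :: int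
  have supp: "{i. f i \<noteq> 0} = int ` {n. f (int n) \<noteq> 0}"
    if "\<And>i. f i \<in> int_grading R i" for f :: "int \<Rightarrow> 'a"
  proof (intro set_eqI iffI)
    fix i assume i: "i \<in> {i. f i \<noteq> 0}"
    have "i \<ge> 0"
      using that[of i] i by (auto simp: int_grading_def split: if_splits)
    then show "i \<in> int ` {n. f (int n) \<noteq> 0}"
      using i by (intro image_eqI[of _ _ "nat i"]) auto
  qed auto
  show "\<exists>!f. ?P f"
  proof (rule ex1I[of _ g])
    have mem: "g i \<in> int_grading R i" for i
      by (auto simp: g_def int_grading_def component_mem[OF direct_sum])
    show "?P g"
      using mem unfolding supp[of g, OF mem]
      by (simp add: sum.reindex g_def sum_component[OF direct_sum]
          finite_support_component[OF direct_sum])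
  next
    fix f assume f: "?P f"
    then have mem: "\<And>i. f i \<in> int_grading R i" by blast
    have "component R x = (\<lambda>n. f (int n))"
    proof (rule component_unique[OF direct_sum, where A = "{n. f (int n) \<noteq> 0}"])
      fix n show "f (int n) \<in> R n"
        using mem[of "int n"] by (simp add: int_grading_def)
    next
      show "finite {n. f (int n) \<noteq> 0}"
        using f unfolding supp[of f, OF mem] by (simp add: finite_image_iff)
      show "x = (\<Sum>n | f (int n) \<noteq> 0. f (int n))"
        using f unfolding supp[of f, OF mem] by (simp add: sum.reindex)
    qed simp
    moreover have "f i = 0" if "i < 0" for i
      using mem[of i] that by (simp add: int_grading_def)
    ultimately show "f = g"
      by (auto simp: g_def fun_eq_iff)
  qed
qed

lemma int_grading_int [simp]: "int_grading R (int n) = R n"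
  by (simp add: int_grading_def)

lemma int_grading_neg: "i < 0 \<Longrightarrow> int_grading R i = {0}"
  by (simp add: int_grading_def)

lemma int_grading_vanishes: "\<forall>i<0. int_grading R i = {0}"
  by (simp add: int_grading_neg)

lemma module_mult: "module ((*) :: 'a \<Rightarrow> 'a \<Rightarrow> 'a)"
  by standard (auto simp: algebra_simps)

sublocale ring: graded_module "(*)" R "int_grading R"
proof (intro graded_module.intro graded_module_axioms.intro)
  fix a i x j assume "a \<in> R i" "x \<in> int_grading R j"
  then show "a * x \<in> int_grading R (int i + j)"
    using mult_closed[of a i x "nat j"] direct_sum_zero[OF is_direct_sum_int_grading]
    by (cases "j < 0") (auto simp: int_grading_def nat_add_distrib split: if_splits)
qed (auto simp: module_mult is_direct_sum_int_grading)

abbreviation ring_component :: "'a \<Rightarrow> int \<Rightarrow> 'a" where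
  "ring_component \<equiv> component (int_grading R)"

end

section \<open>Graded submodules and products with ideals\<close>

locale graded_algebra_module =
  alg?: standard_graded_algebra K R + graded_module scale R M
  for K :: "'a::comm_ring_1 set" and R :: "nat \<Rightarrow> 'a set"
    and scale :: "'a \<Rightarrow> 'm::ab_group_add \<Rightarrow> 'm" and M :: "int \<Rightarrow> 'm set"

text \<open>Every later lemma on graded submodules thereby applies to graded ideals, under the
  prefix \<open>ring\<close>.\<close>

sublocale standard_graded_algebra \<subseteq> ring: graded_algebra_module K R "(*)" "int_grading R"
  by unfold_locales

context graded_algebra_module
begin

lemmas M_zero = direct_sum_zero[OF direct_sum]

lemma scale_closed_int: "a \<in> int_grading R i \<Longrightarrow> x \<in> M j \<Longrightarrow> scale a x \<in> M (i + j)"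
  using scale_closed[of a "nat i" x j] M_zero
  by (auto simp: int_grading_def split: if_splits)

lemma component_scale:
  assumes "x \<in> M j"
  shows "component M (scale a x) k = scale (ring_component a (k - j)) x"
proof -
  let ?A = "{i. ring_component a i \<noteq> 0}"
  have "component M (scale a x) = (\<lambda>k. scale (ring_component a (k - j)) x)"
  proof (rule component_unique[OF direct_sum, where A = "(\<lambda>i. i + j) ` ?A"])
    show "scale (ring_component a (k - j)) x \<in> M k" for k
      using scale_closed_int[OF component_mem[OF is_direct_sum_int_grading] assms, of a "k - j"]
      by simp
    show "finite ((\<lambda>i. i + j) ` ?A)"
      by (simp add: finite_support_component[OF is_direct_sum_int_grading])
    show "scale (ring_component a (k - j)) x = 0" if "k \<notin> (\<lambda>i. i + j) ` ?A" for k
      using that by (auto simp: image_iff) (metis diff_add_cancel scale_zero_left)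
    show "scale a x = (\<Sum>k\<in>(\<lambda>i. i + j) ` ?A. scale (ring_component a (k - j)) x)"
      by (subst sum.reindex)
        (auto simp: scale_sum_left[symmetric] sum_component[OF is_direct_sum_int_grading] inj_on_def)
  qed
  then show ?thesis by simp
qed

text \<open>In degree \<open>k\<close>, only the part of degree \<open>k - j\<close> of a
  coefficient of \<open>s\<close> in \<open>M j\<close> survives. So it suffices to treat
  homogeneous multiples whose degrees add up to \<open>k\<close>; all degree counts below rest on
  this.\<close>

lemma homogeneous_span_induct [consumes 2, case_names zero add scale]:
  assumes "x \<in> span S" "S \<subseteq> (\<Union>j. M j)"
    and "Q 0" "\<And>y z. Q y \<Longrightarrow> Q z \<Longrightarrow> Q (y + z)"
    and "\<And>s j a i. s \<in> S \<Longrightarrow> s \<in> M j \<Longrightarrow> a \<in> R i \<Longrightarrow> int i + j = k \<Longrightarrow> Q (scale a s)"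
  shows "Q (component M x k)"
  using assms(1)
proof (induct rule: span_induct_alt)
  case base
  then show ?case
    using assms(3) by (simp add: component_zero[OF direct_sum])
next
  case (step c s y)
  then obtain j where j: "s \<in> M j"
    using assms(2) by auto
  have "Q (scale (ring_component c (k - j)) s)"
  proof (cases "k - j < 0")
    case True
    then show ?thesis
      using component_mem[OF is_direct_sum_int_grading, of c "k - j"] assms(3)
      by (simp add: int_grading_neg)
  next
    case False
    then show ?thesis
      using component_mem[OF is_direct_sum_int_grading, of c "k - j"] assms(5)[OF step(1) j]
      by (simp add: int_grading_def)
  qed
  then show ?case
    using step by (simp add: component_add[OF direct_sum] component_scale[OF j] assms(4))
qed

lemma homogeneous_in_span_induct [consumes 3, case_names zero add scale]:
  assumes "x \<in> span S" "x \<in> M k" "S \<subseteq> (\<Union>j. M j)"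
    and "Q 0" "\<And>y z. Q y \<Longrightarrow> Q z \<Longrightarrow> Q (y + z)"
    and "\<And>s j a i. s \<in> S \<Longrightarrow> s \<in> M j \<Longrightarrow> a \<in> R i \<Longrightarrow> int i + j = k \<Longrightarrow> Q (scale a s)"
  shows "Q x"
  using homogeneous_span_induct[of x S Q k] assms component_homogeneous[OF direct_sum assms(2)]
  by simp

lemma components_mem_imp_in_span_homogeneous:
  assumes "\<And>k. component M x k \<in> N"
  shows "x \<in> span (N \<inter> (\<Union>j. M j))"
proof -
  have "(\<Sum>i | component M x i \<noteq> 0. component M x i) \<in> span (N \<inter> (\<Union>j. M j))"
    using assms component_mem[OF direct_sum] by (intro span_sum span_base) auto
  then show ?thesis
    by (simp add: sum_component[OF direct_sum])
qed

text \<open>By uniqueness of the decomposition, the summands supplied by \<open>finite_sums\<close>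
  are the components themselves.\<close>

lemma graded_submodule_iff:
  "graded_submodule scale M N \<longleftrightarrow> subspace N \<and> (\<forall>x\<in>N. \<forall>k. component M x k \<in> N)"
proof (intro iffI conjI ballI allI)
  assume N: "graded_submodule scale M N"
  then show sub: "subspace N"
    by (simp add: graded_submodule_def)
  fix x k assume "x \<in> N"
  then obtain F f where f: "finite F" "x = (\<Sum>i\<in>F. f i)" "\<forall>i\<in>F. f i \<in> N \<inter> M i"
    using N unfolding graded_submodule_def finite_sums_def by blast
  have "component M x = (\<lambda>i. if i \<in> F then f i else 0)"
    using f M_zero by (intro component_unique[OF direct_sum, where A = F]) auto
  then show "component M x k \<in> N"
    using f subspace_0[OF sub] by simp
next
  assume N: "subspace N \<and> (\<forall>x\<in>N. \<forall>k. component M x k \<in> N)"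
  have "x \<in> finite_sums UNIV (\<lambda>n. N \<inter> M n)" if "x \<in> N" for x
    unfolding finite_sums_def
    using sum_component[OF direct_sum, of x] finite_support_component[OF direct_sum, of x]
      component_mem[OF direct_sum, of x] N that
    by (intro CollectI exI[of _ "{i. component M x i \<noteq> 0}"] exI[of _ "component M x"]) auto
  then show "graded_submodule scale M N"
    using N by (auto simp: graded_submodule_def)
qed

lemma graded_subspace: "graded_submodule scale M N \<Longrightarrow> subspace N"
  by (simp add: graded_submodule_def)

lemma graded_span:
  assumes "S \<subseteq> (\<Union>j. M j)"
  shows "graded_submodule scale M (span S)"
  unfolding graded_submodule_iff
proof (intro conjI ballI allI)
  fix x k assume "x \<in> span S"
  then show "component M x k \<in> span S"
    using assms by (induct rule: homogeneous_span_induct) (auto intro: span_zero span_add span_scale span_base)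
qed simp

lemma graded_UNIV: "graded_submodule scale M UNIV"
  by (simp add: graded_submodule_iff)

lemma graded_eq_span:
  assumes "graded_submodule scale M N"
  shows "N = span (N \<inter> (\<Union>j. M j))"
proof
  show "N \<subseteq> span (N \<inter> (\<Union>j. M j))"
    using assms components_mem_imp_in_span_homogeneous[of _ N] by (auto simp: graded_submodule_iff)
  show "span (N \<inter> (\<Union>j. M j)) \<subseteq> N"
    using graded_subspace[OF assms] by (intro span_minimal) auto
qed

lemma subspace_preimage_scale:
  assumes "subspace P"
  shows "subspace {x. scale c x \<in> P}"
proof (rule subspaceI)
  fix b x assume "x \<in> {x. scale c x \<in> P}"
  then have "scale b (scale c x) \<in> P"
    using subspace_scale[OF assms] by blast
  then show "scale b x \<in> {x. scale c x \<in> P}"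
    by (simp add: mult.commute)
qed (auto simp: scale_right_distrib subspace_0[OF assms] subspace_add[OF assms])

lemma subspace_annihilated: "subspace {x. scale c x = 0}"
  using subspace_preimage_scale[OF subspace_single_0] by simp

text \<open>The colon ideal of \<open>N\<close> into \<open>P\<close>, used with
  \<open>P = {0}\<close> for annihilators and with \<open>P = J \<odot> N\<close> for
  reductions.\<close>

lemma is_ideal_colon:
  assumes "subspace P"
  shows "is_ideal {a. \<forall>x\<in>N. scale a x \<in> P}"
proof (rule ring.subspaceI)
  fix b a assume "a \<in> {a. \<forall>x\<in>N. scale a x \<in> P}"
  then have "\<forall>x\<in>N. scale b (scale a x) \<in> P"
    using subspace_scale[OF assms] by blast
  then show "b * a \<in> {a. \<forall>x\<in>N. scale a x \<in> P}"
    by simp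
qed (auto simp: scale_left_distrib subspace_0[OF assms] subspace_add[OF assms])

section \<open>Products of sets of scalars with sets of module elements\<close>

abbreviation times :: "'a set \<Rightarrow> 'm set \<Rightarrow> 'm set" (infixr "\<odot>" 75) where
  "J \<odot> N \<equiv> ideal_module_prod scale J N"

lemma times_memI: "a \<in> J \<Longrightarrow> x \<in> N \<Longrightarrow> scale a x \<in> J \<odot> N"
  unfolding ideal_module_prod_def by (intro span_base) auto

lemma subspace_times [simp]: "subspace (J \<odot> N)"
  by (simp add: ideal_module_prod_def)

lemma times_subsetI:
  "(\<And>a x. a \<in> J \<Longrightarrow> x \<in> N \<Longrightarrow> scale a x \<in> P) \<Longrightarrow> subspace P \<Longrightarrow> J \<odot> N \<subseteq> P"
  unfolding ideal_module_prod_def by (intro span_minimal) auto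

lemma times_mono: "J \<subseteq> J' \<Longrightarrow> N \<subseteq> N' \<Longrightarrow> J \<odot> N \<subseteq> J' \<odot> N'"
  by (intro times_subsetI) (auto intro: times_memI)

lemma times_subset: "subspace N \<Longrightarrow> J \<odot> N \<subseteq> N"
  by (intro times_subsetI) (auto intro: subspace_scale)

text \<open>Together with \<open>times_span_right\<close> this allows each factor of a product to be
  replaced by generators, in particular by homogeneous elements.\<close>

lemma times_span_left: "ideal_span A \<odot> N = A \<odot> N"
proof
  show "ideal_span A \<odot> N \<subseteq> A \<odot> N"
  proof (rule times_subsetI)
    fix a x assume "a \<in> ideal_span A" and x: "x \<in> N"
    then show "scale a x \<in> A \<odot> N"
    proof (induct rule: ring.span_induct_alt)
      case base
      show ?case using subspace_0[OF subspace_times] by simp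
    next
      case (step c a b)
      have "scale c (scale a x) + scale b x \<in> A \<odot> N"
        using subspace_add[OF subspace_times subspace_scale[OF subspace_times times_memI[OF step(1) x]] step(2)[OF x]] .
      then show ?case by (simp add: scale_left_distrib)
    qed
  qed simp
qed (simp add: times_mono ring.span_superset)

lemma times_span_right: "A \<odot> span N = A \<odot> N"
proof
  show "A \<odot> span N \<subseteq> A \<odot> N"
  proof (rule times_subsetI)
    fix a x assume a: "a \<in> A" and "x \<in> span N"
    from this(2) show "scale a x \<in> A \<odot> N"
    proof (induct rule: span_induct_alt)
      case base
      show ?case using subspace_0[OF subspace_times] by simp
    next
      case (step c x y)
      have "scale c (scale a x) + scale a y \<in> A \<odot> N"
        using subspace_add[OF subspace_times subspace_scale[OF subspace_times times_memI[OF a step(1)]] step(2)] .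
      then show ?case by (simp add: scale_right_distrib mult.commute)
    qed
  qed simp
qed (simp add: times_mono span_superset)

lemma times_assoc: "ideal_module_prod (*) A B \<odot> N = A \<odot> B \<odot> N"
proof -
  have "ideal_module_prod (*) A B \<odot> N = {a * b | a b. a \<in> A \<and> b \<in> B} \<odot> N"
    by (simp add: ideal_module_prod_def[of "(*)"] times_span_left)
  also have "\<dots> = A \<odot> {scale b x | b x. b \<in> B \<and> x \<in> N}"
    unfolding ideal_module_prod_def by (rule arg_cong[where f = span]) (auto; metis scale_scale)
  also have "\<dots> = A \<odot> B \<odot> N"
    by (simp add: ideal_module_prod_def[of scale B] times_span_right)
  finally show ?thesis .
qed

lemma times_left_commute: "A \<odot> B \<odot> N = B \<odot> A \<odot> N"
proof -
  have "ideal_module_prod (*) A B = ideal_module_prod (*) B A"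
    unfolding ideal_module_prod_def by (rule arg_cong[where f = ring.span]) (auto; metis mult.commute)
  then show ?thesis
    by (metis times_assoc)
qed

end

context graded_algebra_module
begin

lemma graded_times:
  assumes "graded_ideal R J" "graded_submodule scale M N"
  shows "graded_submodule scale M (J \<odot> N)"
proof -
  have "J \<odot> N = (J \<inter> (\<Union>i. int_grading R i)) \<odot> (N \<inter> (\<Union>j. M j))"
    using ring.graded_eq_span[OF assms(1)] graded_eq_span[OF assms(2)] times_span_left times_span_right
    by metis
  also have "graded_submodule scale M \<dots>"
    unfolding ideal_module_prod_def by (intro graded_span) (auto intro: scale_closed_int)
  finally show ?thesis .
qed

lemma finitely_generated_times:
  assumes "finite A" "J = ideal_span A" "finite X" "N = span X"
  shows "\<exists>B. finite B \<and> J \<odot> N = span B"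
proof (intro exI conjI)
  show "J \<odot> N = span {scale a x | a x. a \<in> A \<and> x \<in> X}"
    using assms by (simp add: times_span_left times_span_right) (simp add: ideal_module_prod_def)
  have "{scale a x | a x. a \<in> A \<and> x \<in> X} = (\<lambda>(a, x). scale a x) ` (A \<times> X)"
    by auto
  then show "finite {scale a x | a x. a \<in> A \<and> x \<in> X}"
    using assms by simp
qed

end

section \<open>Generators and the irrelevant ideal\<close>

context standard_graded_algebra
begin

lemma subset_irrelevant_ideal: "i > 0 \<Longrightarrow> R i \<subseteq> irrelevant_ideal R"
proof
  fix x assume "i > 0" "x \<in> R i"
  then show "x \<in> irrelevant_ideal R"
    unfolding irrelevant_ideal_def finite_sums_def
    by (intro CollectI exI[of _ "{i}"] exI[of _ "\<lambda>_. x"]) auto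
qed

lemma irrelevant_ideal_subset: "irrelevant_ideal R \<subseteq> ideal_span (\<Union>i\<in>{0<..}. R i)"
proof
  fix x assume "x \<in> irrelevant_ideal R"
  then obtain F f where f: "F \<subseteq> {n. n > 0}" "\<forall>i\<in>F. f i \<in> R i" "x = sum f F"
    unfolding irrelevant_ideal_def finite_sums_def by blast
  then show "x \<in> ideal_span (\<Union>i\<in>{0<..}. R i)"
    by (auto intro!: ring.span_sum intro: ring.span_base)
qed

lemma R_subset_homogeneous: "R i \<subseteq> (\<Union>j. int_grading R j)"
  using int_grading_int by blast

lemma K_subring: "is_subring K"
  using field by (simp add: is_subfield_def)

text \<open>The sums of an element of \<open>R 0\<close> and an element of the ideal generated by
  \<open>R 1\<close> form a subring containing \<open>K\<close> and \<open>R 1\<close>, hence are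
  everything. In degree \<open>i > 0\<close> the summand from \<open>R 0\<close> disappears.\<close>

lemma positive_degree_in_span_linear:
  assumes "i > 0"
  shows "R i \<subseteq> ideal_span (R 1)"
proof
  fix r assume r: "r \<in> R i"
  define A where "A = {a + j | a j. a \<in> R 0 \<and> j \<in> ideal_span (R 1)}"
  have K: "1 \<in> R 0" "0 \<in> R 0" "\<And>x y. x \<in> R 0 \<Longrightarrow> y \<in> R 0 \<Longrightarrow> x - y \<in> R 0 \<and> x * y \<in> R 0"
    using K_subring direct_sum_zero[OF direct_sum, of 0] by (auto simp: degree_zero is_subring_def)
  have "is_subring A"
    unfolding is_subring_def
  proof (intro conjI ballI)
    show "1 \<in> A"
      using K ring.span_zero by (force simp: A_def)
    fix x y assume "x \<in> A" "y \<in> A"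
    then obtain a b j l where xy: "x = a + j" "y = b + l"
      "a \<in> R 0" "b \<in> R 0" "j \<in> ideal_span (R 1)" "l \<in> ideal_span (R 1)"
      by (auto simp: A_def)
    have "x - y = (a - b) + (j - l)" "x * y = a * b + (a * l + y * j)"
      by (simp_all add: xy algebra_simps)
    moreover have "j - l \<in> ideal_span (R 1)" "a * l + y * j \<in> ideal_span (R 1)"
      using xy ring.span_diff ring.span_add ring.span_scale by blast+
    ultimately show "x - y \<in> A" "x * y \<in> A"
      using K xy unfolding A_def by blast+
  qed
  moreover have "K \<union> R 1 \<subseteq> A"
    using K ring.span_zero ring.span_base[of _ "R 1"]
    by (auto simp: A_def degree_zero) (metis add.right_neutral, metis add.left_neutral)
  ultimately have "is_subring hull (K \<union> R 1) \<subseteq> A"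
    by (intro hull_minimal)
  then obtain a j where aj: "r = a + j" "a \<in> R 0" "j \<in> ideal_span (R 1)"
    unfolding generated_in_degree_one A_def by blast
  have "ring_component j (int i) \<in> ideal_span (R 1)"
    using ring.graded_span[OF R_subset_homogeneous] aj(3)
    by (simp add: ring.graded_submodule_iff)
  moreover have "ring_component r (int i) = r"
    using component_homogeneous[OF is_direct_sum_int_grading, of r "int i"] r by simp
  moreover have "ring_component a (int i) = 0"
    using component_homogeneous[OF is_direct_sum_int_grading, of a 0] aj(2) assms
    by (simp add: int_grading_def)
  ultimately show "r \<in> ideal_span (R 1)"
    using component_add[OF is_direct_sum_int_grading, of a j "int i"] aj(1) by simp
qed

lemma ideal_span_linear_forms: "ideal_span (R 1 - {0}) = ideal_span (R 1)"
proof -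
  have "R 1 \<subseteq> ideal_span (R 1 - {0})"
    using ring.span_base[of _ "R 1 - {0}"] ring.span_zero by blast
  then show ?thesis
    using ring.span_mono[of "R 1 - {0}" "R 1"] ring.span_minimal[of "R 1"] by blast
qed

end

section \<open>Bounds for the degrees of generators\<close>

context graded_algebra_module
begin

lemma times_irrelevant: "irrelevant_ideal R \<odot> N = (\<Union>i\<in>{0<..}. R i) \<odot> N"
proof
  show "irrelevant_ideal R \<odot> N \<subseteq> (\<Union>i\<in>{0<..}. R i) \<odot> N"
    using times_mono[OF irrelevant_ideal_subset order_refl] by (simp add: times_span_left)
  show "(\<Union>i\<in>{0<..}. R i) \<odot> N \<subseteq> irrelevant_ideal R \<odot> N"
    using subset_irrelevant_ideal by (intro times_mono) auto
qed

text \<open>For the nonzero modules considered in \<open>max_gen_degree_props\<close>,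
  \<open>D(N)\<close> is the least such \<open>e\<close>; working with arbitrary bounds postpones
  the question whether the maximum exists.\<close>

definition generated_upto :: "'m set \<Rightarrow> int \<Rightarrow> bool" where
  "generated_upto N e \<longleftrightarrow> N \<subseteq> span (\<Union>j\<in>{..e}. N \<inter> M j)"

lemma generated_upto_eq:
  assumes "graded_submodule scale M N" "generated_upto N e"
  shows "N = span (\<Union>j\<in>{..e}. N \<inter> M j)"
proof
  show "span (\<Union>j\<in>{..e}. N \<inter> M j) \<subseteq> N"
    using graded_subspace[OF assms(1)] by (intro span_minimal) auto
qed (use assms in \<open>simp add: generated_upto_def\<close>)

lemma exists_generated_upto:
  assumes "graded_submodule scale M N" "finite B" "N = span B"
  shows "\<exists>e. generated_upto N e"
proof -
  define A where "A = (\<Union>b\<in>B. {i. component M b i \<noteq> 0})"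
  have "finite A"
    using assms(2) finite_support_component[OF direct_sum] by (auto simp: A_def)
  then obtain e where e: "\<And>i. i \<in> A \<Longrightarrow> i \<le> e"
    by (meson Max_ge)
  have "b \<in> span (\<Union>j\<in>{..e}. N \<inter> M j)" if "b \<in> B" for b
  proof -
    have "b \<in> N"
      using that by (simp add: assms(3) span_base)
    then have "(\<Sum>i | component M b i \<noteq> 0. component M b i) \<in> span (\<Union>j\<in>{..e}. N \<inter> M j)"
      using assms(1) e that component_mem[OF direct_sum]
      by (intro span_sum span_base) (auto simp: A_def graded_submodule_iff)
    then show ?thesis
      by (simp add: sum_component[OF direct_sum])
  qed
  then show ?thesis
    unfolding generated_upto_def by (subst assms(3)) (intro exI[of _ e] span_minimal, auto)
qed

text \<open>In degree \<open>k > e\<close> every homogeneous coefficient of a generator of degree at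
  most \<open>e\<close> has positive degree.\<close>

lemma generated_upto_imp_in_irrelevant:
  assumes "graded_submodule scale M N" "generated_upto N e" "e < k"
  shows "N \<inter> M k \<subseteq> irrelevant_ideal R \<odot> N"
proof
  fix x assume "x \<in> N \<inter> M k"
  then have "x \<in> span (\<Union>j\<in>{..e}. N \<inter> M j)" "x \<in> M k" "(\<Union>j\<in>{..e}. N \<inter> M j) \<subseteq> (\<Union>j. M j)"
    using generated_upto_eq[OF assms(1,2)] by auto
  then show "x \<in> irrelevant_ideal R \<odot> N"
  proof (induct rule: homogeneous_in_span_induct)
    case (scale s j a i)
    \<comment> \<open>The induction and the generating set each supply a degree for
      \<open>s\<close>. They agree only if \<open>s\<close> is nonzero, hence the case distinction;
      it recurs in the later degree counts.\<close>
    show ?case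
    proof (cases "s = 0")
      case False
      from scale(1) obtain j' where j': "j' \<le> e" "s \<in> N" "s \<in> M j'"
        by auto
      with scale(2) False have "j' = j"
        using direct_sum_disjoint[OF direct_sum] by blast
      then have "i > 0"
        using j'(1) scale(4) assms(3) by linarith
      then show ?thesis
        using subset_irrelevant_ideal scale(3) j'(2) by (intro times_memI) auto
    qed (simp add: subspace_0)
  qed (auto simp: subspace_0 subspace_add)
qed

text \<open>Graded Nakayama: an element of degree above \<open>e\<close> is a sum of positive-degree
  multiples of elements of smaller degree, and the descent stops because \<open>M\<close> vanishes
  below \<open>d\<close>.\<close>

lemma in_irrelevant_imp_generated_upto:
  assumes N: "graded_submodule scale M N" and d: "\<forall>j<d. M j = {0}"
    and irr: "\<And>k. e < k \<Longrightarrow> N \<inter> M k \<subseteq> irrelevant_ideal R \<odot> N"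
  shows "generated_upto N e"
proof -
  let ?T = "span (\<Union>j\<in>{..e}. N \<inter> M j)"
  have *: "N \<inter> M k \<subseteq> ?T" for k
  proof (induct "nat (k - d)" arbitrary: k rule: less_induct)
    case less
    consider "k \<le> e" | "k < d" | "k > e" "k \<ge> d"
      by linarith
    then show ?case
    proof cases
      case 1
      then have "N \<inter> M k \<subseteq> (\<Union>j\<in>{..e}. N \<inter> M j)" by auto
      then show ?thesis using span_superset order_trans by blast
    next
      case 2
      then show ?thesis using d span_zero by auto
    next
      case 3
      \<comment> \<open>Passing to homogeneous elements of \<open>N\<close> gives both factors a
        degree, so the second factor has degree below \<open>k\<close>.\<close>
      have "(\<Union>i\<in>{0<..}. R i) \<odot> N = (\<Union>i\<in>{0<..}. R i) \<odot> (N \<inter> (\<Union>j. M j))"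
        using graded_eq_span[OF N] times_span_right by metis
      also have "\<dots> = span {scale a x | a x. (\<exists>i>0. a \<in> R i) \<and> (\<exists>j. x \<in> N \<inter> M j)}"
        unfolding ideal_module_prod_def by (rule arg_cong[where f = span]) blast
      finally have span: "(\<Union>i\<in>{0<..}. R i) \<odot> N = \<dots>" .
      have hom: "{scale a x | a x. (\<exists>i>0. a \<in> R i) \<and> (\<exists>j. x \<in> N \<inter> M j)} \<subseteq> (\<Union>j. M j)"
        by (auto intro: scale_closed)
      show ?thesis
      proof
        fix x assume "x \<in> N \<inter> M k"
        then have "x \<in> span {scale a x | a x. (\<exists>i>0. a \<in> R i) \<and> (\<exists>j. x \<in> N \<inter> M j)}" "x \<in> M k"
          using irr[OF 3(1)] by (auto simp: times_irrelevant span)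
        then show "x \<in> ?T"
          using hom
        proof (induct rule: homogeneous_in_span_induct)
          case (scale s j b l)
          then obtain a i x h where s: "s = scale a x" "i > 0" "a \<in> R i" "x \<in> N" "x \<in> M h"
            by auto
          show ?case
          proof (cases "s = 0")
            case False
            then have "x \<noteq> 0"
              using s(1) by auto
            then have "h \<ge> d"
              using d s(5) by (cases "h < d") auto
            moreover have "j = int i + h"
              using False scale(2) scale_closed[OF s(3,5)] s(1) direct_sum_disjoint[OF direct_sum] by blast
            ultimately have "x \<in> ?T"
              using less[of h] s(2,4,5) scale(4) by auto
            then show ?thesis
              using s(1) by (simp add: span_scale)
          qed (simp add: span_zero)
        qed (auto simp: span_zero span_add)
      qed
    qed
  qed
  have "N = span (N \<inter> (\<Union>j. M j))"
    by (rule graded_eq_span[OF N])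
  also have "\<dots> \<subseteq> ?T"
    using * by (intro span_minimal) auto
  finally show ?thesis
    by (simp add: generated_upto_def)
qed

text \<open>The two preceding lemmas say that \<open>e\<close> bounds the generator degrees exactly
  when \<open>N\<close> agrees with \<open>R\<^sub>+N\<close> in all degrees above \<open>e\<close>,
  which turns the \<open>GREATEST\<close> into a least bound.\<close>

lemma max_gen_degree_props:
  assumes N: "graded_submodule scale M N" and d: "\<forall>j<d. M j = {0}"
    and e: "generated_upto N e" and "N \<noteq> {0}"
  shows "generated_upto N (max_gen_degree scale R M N)"
    and "max_gen_degree scale R M N \<le> e"
    and "\<not> N \<inter> M (max_gen_degree scale R M N) \<subseteq> irrelevant_ideal R \<odot> N"
    and "d \<le> max_gen_degree scale R M N"
proof -
  let ?P = "\<lambda>n. \<not> N \<inter> M n \<subseteq> irrelevant_ideal R \<odot> N"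
  have bound: "y \<le> e" if "?P y" for y
    using generated_upto_imp_in_irrelevant[OF N e] that by (meson not_less)
  have "\<exists>a. ?P a"
  proof (rule ccontr)
    assume "\<nexists>a. ?P a"
    \<comment> \<open>If no degree were left over, generators below degree \<open>d\<close> would
      suffice, but there \<open>M\<close> is zero.\<close>
    then have "generated_upto N (d - 1)"
      by (intro in_irrelevant_imp_generated_upto[OF N d]) auto
    then have "N \<subseteq> span (\<Union>j\<in>{..d - 1}. N \<inter> M j)"
      by (simp add: generated_upto_def)
    also have "\<dots> \<subseteq> {0}"
      using d by (intro span_minimal) auto
    finally show False
      using \<open>N \<noteq> {0}\<close> subspace_0[OF graded_subspace[OF N]] by auto
  qed
  then obtain a where "?P a" ..
  note greatest = int_Greatest[of ?P, OF this bound, folded max_gen_degree_def]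
  show P: "?P (max_gen_degree scale R M N)"
    using greatest(1) .
  then show "max_gen_degree scale R M N \<le> e"
    by (rule bound)
  show "generated_upto N (max_gen_degree scale R M N)"
    using greatest(2) by (intro in_irrelevant_imp_generated_upto[OF N d]) (auto simp: not_less[symmetric])
  show "d \<le> max_gen_degree scale R M N"
    using P d subspace_0[OF subspace_times[of "irrelevant_ideal R" N]]
    by (cases "max_gen_degree scale R M N < d") auto
qed

end

section \<open>Linear reductions\<close>

text \<open>Used with \<open>q = (b * a) ^ n\<close> and \<open>p = (a * a) ^ n\<close>: the right
  side lies in an ideal as soon as \<open>c - q\<close> and \<open>j\<close> do.\<close>

lemma elimination_identity:
  fixes a :: "'a::comm_ring_1"
  assumes "b = a - j" "q - p = (b * a - a * a) * d"
  shows "c * b - p * a = b * (c - q) + (- (b * a * d) - p) * j"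
proof -
  have "c * b - p * a = b * (c - q) + (b * (q - p) - p * j)"
    by (simp add: assms(1) algebra_simps)
  also have "b * (q - p) = - (b * a * d) * j"
    unfolding assms(2) by (simp add: assms(1) algebra_simps)
  finally show ?thesis
    by (simp add: algebra_simps)
qed

context graded_algebra_module
begin

text \<open>Since \<open>J\<close> is an ideal, all contributions of \<open>x\<close> collect into
  one coefficient in \<open>J\<close>; this isolates the generator to be eliminated.\<close>

lemma times_insert_right:
  assumes "is_ideal J" "y \<in> J \<odot> insert x X"
  shows "\<exists>j\<in>J. y - scale j x \<in> J \<odot> X"
  using assms(2)[unfolded ideal_module_prod_def]
proof (induct rule: span_induct_alt)
  case base
  show ?case
    using ring.subspace_0[OF assms(1)] subspace_0[OF subspace_times[of J X]] by (intro bexI[of _ 0]) auto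
next
  case (step c s y)
  then obtain j where j: "j \<in> J" "y - scale j x \<in> J \<odot> X"
    by blast
  from step(1) obtain a z where s: "s = scale a z" "a \<in> J" "z \<in> insert x X"
    by blast
  show ?case
  proof (cases "z = x")
    case True
    have "scale c s + y - scale (c * a + j) x = y - scale j x"
      using True s by (simp add: scale_left_distrib)
    moreover have "c * a + j \<in> J"
      using j s ring.subspace_add[OF assms(1)] ring.subspace_scale[OF assms(1)] by simp
    ultimately show ?thesis
      using j by metis
  next
    case False
    then have "scale c s + (y - scale j x) \<in> J \<odot> X"
      using s j by (intro subspace_add[OF subspace_times] subspace_scale[OF subspace_times, of s])
        (auto intro: times_memI)
    then show ?thesis
      using j by (intro bexI[of _ j]) (auto simp: algebra_simps)
  qed
qed

text \<open>
  A replacement for the determinant trick: generators are eliminated one at a time, each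
  elimination replacing \<open>a\<close> by \<open>(a - j) a\<close> for some \<open>j \<in> J\<close>.
\<close>

lemma exists_annihilator_congruent_power:
  assumes "finite X" "is_ideal J" "\<And>x. x \<in> X \<Longrightarrow> scale a x \<in> J \<odot> X"
  shows "\<exists>c n. c - a ^ n \<in> J \<and> (\<forall>x\<in>X. scale c x = 0)"
  using assms(1,3)
proof (induct X arbitrary: a rule: finite_induct)
  case empty
  show ?case
    using ring.subspace_0[OF assms(2)] by (intro exI[of _ 1] exI[of _ 0]) simp
next
  case (insert x X)
  note J = ring.subspace_add[OF assms(2)] ring.subspace_scale[OF assms(2)]
  obtain j where j: "j \<in> J" "scale a x - scale j x \<in> J \<odot> X"
    using times_insert_right[OF assms(2) insert(4)] by blast
  \<comment> \<open>This choice puts \<open>b x\<close> into \<open>J \<odot> X\<close>, so that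
    \<open>x\<close> is eliminated.\<close>
  define b where "b = a - j"
  have bx: "scale b x \<in> J \<odot> X"
    using j by (simp add: b_def scale_left_diff_distrib)
  \<comment> \<open>Modulo \<open>J \<odot> X\<close>, \<open>a y\<close> is a multiple of
    \<open>x\<close>, and \<open>b\<close> sends \<open>x\<close> into \<open>J \<odot> X\<close>.
    So the induction hypothesis applies to \<open>b * a\<close> and \<open>X\<close>.\<close>
  have "scale (b * a) y \<in> J \<odot> X" if y: "y \<in> X" for y
  proof -
    obtain l where l: "l \<in> J" "scale a y - scale l x \<in> J \<odot> X"
      using times_insert_right[OF assms(2) insert(4)] y by blast
    have "scale b (scale a y - scale l x) + scale l (scale b x) \<in> J \<odot> X"
      by (intro subspace_add[OF subspace_times] subspace_scale[OF subspace_times] bx l)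
    then show ?thesis
      by (simp add: scale_right_diff_distrib mult.commute)
  qed
  then obtain c n where c: "c - (b * a) ^ n \<in> J" "\<forall>y\<in>X. scale c y = 0"
    using insert(3)[of "b * a"] by blast
  \<comment> \<open>\<open>c\<close> annihilates \<open>X\<close>, hence \<open>J \<odot> X\<close>,
    which contains \<open>b x\<close>.\<close>
  have "J \<odot> X \<subseteq> {y. scale c y = 0}"
    using c(2) subspace_scale[OF subspace_annihilated]
    by (intro times_subsetI subspace_annihilated) blast
  then have "scale (c * b) x = 0"
    using bx by auto
  moreover have "scale (c * b) y = 0" if "y \<in> X" for y
    using c(2) that by (simp add: mult.commute flip: scale_scale)
  \<comment> \<open>Modulo \<open>J\<close>, \<open>b\<close> is \<open>a\<close> and
    \<open>c\<close> is \<open>(b * a) ^ n\<close>, that is \<open>a ^ (2 * n)\<close>; this yields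
    the exponent.\<close>
  moreover have "c * b - a ^ (2 * n + 1) \<in> J"
  proof -
    obtain d where d: "(b * a) ^ n - (a * a) ^ n = (b * a - a * a) * d"
      by (metis power_diff_sumr2)
    have "a ^ (2 * n + 1) = (a * a) ^ n * a"
      by (simp add: power_mult power2_eq_square mult.commute[of a "(a * a) ^ n"])
    then have "c * b - a ^ (2 * n + 1) = b * (c - (b * a) ^ n) + (- (b * a * d) - (a * a) ^ n) * j"
      using elimination_identity[OF b_def d] by simp
    also have "\<dots> \<in> J"
      using J c(1) j(1) by blast
    finally show ?thesis .
  qed
  ultimately show ?case
    by blast
qed

end

section \<open>Ideals containing all forms of large degree\<close>

context standard_graded_algebra
begin

text \<open>A nonzero \<open>y\<close> in \<open>Y\<close> has degree one, so its coefficients in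
  degree \<open>Suc i\<close> may be taken of degree \<open>i\<close>; this splits off one linear
  factor at a time.\<close>

lemma linear_span_induct_step:
  assumes "Y \<subseteq> R 1" "R 1 \<subseteq> ideal_span Y" "x \<in> R (Suc i)"
    and "Q 0" "\<And>y z. Q y \<Longrightarrow> Q z \<Longrightarrow> Q (y + z)"
    and "\<And>a y. a \<in> R i \<Longrightarrow> y \<in> Y \<Longrightarrow> Q (a * y)"
  shows "Q x"
proof -
  have "x \<in> ideal_span Y"
    using positive_degree_in_span_linear[of "Suc i"] ring.span_minimal[OF assms(2)] assms(3) by auto
  moreover have "x \<in> int_grading R (int (Suc i))"
    unfolding int_grading_int by (rule assms(3))
  moreover have "Y \<subseteq> (\<Union>j. int_grading R j)"
    using assms(1) R_subset_homogeneous by blast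
  ultimately show ?thesis
  proof (induct rule: ring.homogeneous_in_span_induct)
    case (scale s j a l)
    show ?case
    proof (cases "s = 0")
      case False
      have "s \<in> int_grading R (int 1)"
        using scale(1) assms(1) unfolding int_grading_int by blast
      then have "j = 1"
        using False scale(2) direct_sum_disjoint[OF is_direct_sum_int_grading] by fastforce
      then have "l = i"
        using scale(4) by simp
      then show ?thesis
        using scale(1,3) assms(6) by simp
    qed (simp add: assms(4))
  qed (use assms in auto)
qed

text \<open>Pigeonhole: \<open>R m\<close> lies in the ideal generated by the monomials of degree
  \<open>m\<close> in \<open>Y\<close>, and for large \<open>m\<close> each monomial contains one of
  the given powers.\<close>

lemma eventually_subset_if_powers_mem:
  assumes "is_ideal A" "finite Y" "Y \<subseteq> R 1" "R 1 \<subseteq> ideal_span Y"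
    and powers: "\<And>y. y \<in> Y \<Longrightarrow> \<exists>q. y ^ q \<in> A"
  shows "\<exists>m0. \<forall>m\<ge>m0. R m \<subseteq> A"
proof -
  define Mon where "Mon m = {\<Prod>y\<in>Y. y ^ f y | f :: 'a \<Rightarrow> nat. sum f Y = m}" for m
  have mon: "R m \<subseteq> ideal_span (Mon m)" for m
  proof (induct m)
    case 0
    have "1 \<in> Mon 0"
      by (auto simp: Mon_def intro!: exI[of _ "\<lambda>_. 0"])
    then show ?case
      using ring.span_scale[OF ring.span_base] by (metis mult.right_neutral subsetI)
  next
    case (Suc m)
    have "y * z \<in> ideal_span (Mon (Suc m))" if "z \<in> Y" "y \<in> ideal_span (Mon m)" for y z
      using that(2)
    proof (induct rule: ring.span_induct_alt)
      case (step c x w)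
      from step(1) obtain f where f: "x = (\<Prod>y\<in>Y. y ^ f y)" "sum f Y = m"
        by (auto simp: Mon_def)
      let ?g = "f(z := Suc (f z))"
      have "(\<Prod>y\<in>Y. y ^ ?g y) = z ^ ?g z * (\<Prod>y\<in>Y - {z}. y ^ ?g y)"
        by (rule prod.remove[OF assms(2) that(1)])
      also have "(\<Prod>y\<in>Y - {z}. y ^ ?g y) = (\<Prod>y\<in>Y - {z}. y ^ f y)"
        by (intro prod.cong) auto
      also have "z ^ ?g z * (\<Prod>y\<in>Y - {z}. y ^ f y) = x * z"
        unfolding f(1) by (simp add: prod.remove[OF assms(2) that(1)] mult.commute mult.left_commute)
      finally have "x * z = (\<Prod>y\<in>Y. y ^ ?g y)" ..
      moreover have "sum ?g Y = ?g z + sum ?g (Y - {z})"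
        by (rule sum.remove[OF assms(2) that(1)])
      moreover have "sum ?g (Y - {z}) = sum f (Y - {z})"
        by (intro sum.cong) auto
      moreover have "sum f Y = f z + sum f (Y - {z})"
        by (rule sum.remove[OF assms(2) that(1)])
      ultimately have "x * z = (\<Prod>y\<in>Y. y ^ ?g y)" "sum ?g Y = Suc m"
        using f(2) by simp_all
      then have "x * z \<in> Mon (Suc m)"
        unfolding Mon_def by blast
      then have "c * (x * z) + w * z \<in> ideal_span (Mon (Suc m))"
        by (intro ring.span_add ring.span_scale ring.span_base step(2))
      then show ?case
        by (simp add: distrib_right)
    qed (simp add: ring.span_zero)
    note * = this
    show ?case
    proof
      fix x assume "x \<in> R (Suc m)"
      then show "x \<in> ideal_span (Mon (Suc m))"
        by (rule linear_span_induct_step[OF assms(3,4)]) (use Suc * in \<open>auto intro: ring.span_zero ring.span_add\<close>)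
    qed
  qed
  obtain q where q: "\<And>y. y \<in> Y \<Longrightarrow> y ^ q y \<in> A"
    using powers by metis
  \<comment> \<open>If all exponents stayed below \<open>q y\<close>, the degree would be at most
    \<open>sum q Y\<close>. The \<open>Suc\<close> excludes this, also for empty
    \<open>Y\<close>.\<close>
  have "Mon m \<subseteq> A" if "m \<ge> Suc (sum q Y)" for m
  proof
    fix x assume "x \<in> Mon m"
    then obtain f where f: "x = (\<Prod>y\<in>Y. y ^ f y)" "sum f Y = m"
      by (auto simp: Mon_def)
    have "\<exists>y\<in>Y. q y \<le> f y"
    proof (rule ccontr)
      assume "\<not> (\<exists>y\<in>Y. q y \<le> f y)"
      then have "sum f Y \<le> sum q Y"
        by (intro sum_mono) force
      then show False
        using f(2) that by simp
    qed
    then obtain y where y: "y \<in> Y" "q y \<le> f y" ..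
    then have "y ^ q y dvd x"
      using f(1) assms(2) by (metis dvd_prodI dvd_trans le_imp_power_dvd)
    then show "x \<in> A"
      using ring.subspace_scale[OF assms(1) q[OF y(1)]] by (metis dvdE mult.commute)
  qed
  then have "\<forall>m\<ge>Suc (sum q Y). R m \<subseteq> A"
    using mon ring.span_minimal[OF _ assms(1)] by blast
  then show ?thesis ..
qed

end

section \<open>Degree bounds for linear reductions\<close>

context graded_algebra_module
begin

text \<open>The counterpart of \<open>generated_upto\<close> for reductions: \<open>r_J(N)\<close>
  is the least such \<open>e\<close> in the setting of
  \<open>reduction_number_wrt_props\<close>.\<close>

definition reduced_above :: "'m set \<Rightarrow> 'a set \<Rightarrow> int \<Rightarrow> bool" where
  "reduced_above N J e \<longleftrightarrow> (\<forall>k>e. N \<inter> M k \<subseteq> J \<odot> N)"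

definition linear_ideal :: "'a set \<Rightarrow> bool" where
  "linear_ideal J \<longleftrightarrow> (\<exists>L \<subseteq> R 1 - {0}. J = ideal_span L)"

text \<open>An ideal generated by linear forms is graded, and \<open>J \<odot> N\<close> lies in
  \<open>N\<close>, so only inclusions in large degrees remain to be checked.\<close>

lemma linear_reduction_iff:
  assumes "subspace N"
  shows "linear_reduction scale R M N J \<longleftrightarrow> linear_ideal J \<and> (\<exists>e. reduced_above N J e)"
proof -
  have "graded_ideal R J" if "linear_ideal J"
    using that ring.graded_span R_subset_homogeneous[of 1] by (auto simp: linear_ideal_def)
  moreover have "J \<odot> N \<inter> M n = N \<inter> M n \<longleftrightarrow> N \<inter> M n \<subseteq> J \<odot> N" for n
    using times_subset[OF assms, of J] by blast
  moreover have "(\<forall>\<^sub>F n in at_top. N \<inter> M n \<subseteq> J \<odot> N) \<longleftrightarrow> (\<exists>e. reduced_above N J e)"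
    by (simp add: eventually_at_top_dense reduced_above_def)
  ultimately show ?thesis
    unfolding linear_reduction_def linear_ideal_def[symmetric] by auto
qed

lemma is_ideal_linear_ideal: "linear_ideal J \<Longrightarrow> is_ideal J"
  by (auto simp: linear_ideal_def)

lemma linear_ideal_times_subset_irrelevant:
  assumes "linear_ideal J"
  shows "J \<odot> N \<subseteq> irrelevant_ideal R \<odot> N"
proof -
  obtain L where "L \<subseteq> R 1" "J = ideal_span L"
    using assms by (auto simp: linear_ideal_def)
  then show ?thesis
    using subset_irrelevant_ideal[of 1] times_mono[of L "irrelevant_ideal R" N N]
    by (simp add: times_span_left)
qed

text \<open>In degree \<open>D(N)\<close> some element lies outside \<open>R\<^sub>+N\<close>, hence
  outside \<open>J \<odot> N\<close>. So the \<open>GREATEST\<close> ranges over a nonempty set, and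
  \<open>D(N)\<close> bounds \<open>r_J(N)\<close> from below.\<close>

lemma reduction_number_wrt_props:
  assumes N: "graded_submodule scale M N" "N \<noteq> {0}" and d: "\<forall>j<d. M j = {0}"
    and e: "generated_upto N e" and J: "linear_reduction scale R M N J"
  shows "reduced_above N J (reduction_number_wrt scale M N J)"
    and "reduced_above N J l \<Longrightarrow> reduction_number_wrt scale M N J \<le> l"
    and "max_gen_degree scale R M N \<le> reduction_number_wrt scale M N J"
proof -
  let ?P = "\<lambda>n. J \<odot> N \<inter> M n \<noteq> N \<inter> M n"
  have P: "?P n \<longleftrightarrow> \<not> N \<inter> M n \<subseteq> J \<odot> N" for n
    using times_subset[OF graded_subspace[OF N(1)], of J] by blast
  have J': "linear_ideal J" "\<exists>l. reduced_above N J l"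
    using J linear_reduction_iff[OF graded_subspace[OF N(1)]] by auto
  have D: "?P (max_gen_degree scale R M N)"
    unfolding P using max_gen_degree_props(3)[OF N(1) d e N(2)] linear_ideal_times_subset_irrelevant[OF J'(1)]
    by (meson order_trans)
  have bound: "y \<le> l" if "reduced_above N J l" "?P y" for l y
    using that unfolding P reduced_above_def by (meson not_less)
  obtain l' where "reduced_above N J l'"
    using J'(2) ..
  note greatest = int_Greatest[where P = ?P, OF D bound[OF this], folded reduction_number_wrt_def]
  show "reduced_above N J (reduction_number_wrt scale M N J)"
    unfolding reduced_above_def using greatest(2) P by (meson not_less)
  show "max_gen_degree scale R M N \<le> reduction_number_wrt scale M N J"
    using greatest(2) D by blast
  show "reduced_above N J l \<Longrightarrow> reduction_number_wrt scale M N J \<le> l"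
    using bound[of l] greatest(1) by blast
qed

text \<open>All linear forms together generate \<open>R\<^sub>+\<close>, so beyond the generator
  degrees nothing is lost. This provides at least one linear reduction.\<close>

lemma linear_reduction_irrelevant:
  assumes "graded_submodule scale M N" "generated_upto N e"
  shows "linear_reduction scale R M N (ideal_span (R 1 - {0}))"
proof -
  have "irrelevant_ideal R \<odot> N \<subseteq> ideal_span (R 1) \<odot> N"
    unfolding times_irrelevant using positive_degree_in_span_linear by (intro times_mono) auto
  then have "reduced_above N (ideal_span (R 1 - {0})) e"
    unfolding reduced_above_def ideal_span_linear_forms
    using generated_upto_imp_in_irrelevant[OF assms] by blast
  then show ?thesis
    using linear_reduction_iff[OF graded_subspace[OF assms(1)]] by (auto simp: linear_ideal_def)
qed

lemma times_generated_upto: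
  assumes I: "graded_ideal R I" "ring.generated_upto I r" and N: "graded_submodule scale M N"
  shows "I \<odot> N = span {scale a x | a x i h. i \<le> r \<and> a \<in> I \<inter> int_grading R i \<and> x \<in> N \<inter> M h}"
proof -
  have "I \<odot> N = (\<Union>i\<in>{..r}. I \<inter> int_grading R i) \<odot> (N \<inter> (\<Union>j. M j))"
    using ring.generated_upto_eq[OF I] graded_eq_span[OF N] times_span_left times_span_right by metis
  also have "\<dots> = span {scale a x | a x i h. i \<le> r \<and> a \<in> I \<inter> int_grading R i \<and> x \<in> N \<inter> M h}"
    unfolding ideal_module_prod_def by (rule arg_cong[where f = span]) blast
  finally show ?thesis .
qed

text \<open>In a term \<open>b a y\<close> of degree above \<open>r + e\<close> with
  \<open>a\<close> of degree at most \<open>r\<close>, the element \<open>b y\<close> has degree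
  above \<open>e\<close> and so lies in \<open>J \<odot> N\<close>; then \<open>a\<close> is moved
  past \<open>J\<close>.\<close>

lemma reduced_above_times:
  assumes I: "graded_ideal R I" "ring.generated_upto I r" and N: "graded_submodule scale M N"
    and J: "reduced_above N J e"
  shows "reduced_above (I \<odot> N) J (r + e)"
  unfolding reduced_above_def
proof (intro allI impI subsetI)
  fix k x assume k: "r + e < k" and x: "x \<in> I \<odot> N \<inter> M k"
  let ?S = "{scale a x | a x i h. i \<le> r \<and> a \<in> I \<inter> int_grading R i \<and> x \<in> N \<inter> M h}"
  have "x \<in> span ?S" "x \<in> M k" "?S \<subseteq> (\<Union>j. M j)"
    using x times_generated_upto[OF I N] by (auto intro: scale_closed_int)
  then show "x \<in> J \<odot> I \<odot> N"
  proof (induct rule: homogeneous_in_span_induct)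
    case (scale s j b l)
    then obtain a y i h where s: "s = scale a y" "i \<le> r" "a \<in> I" "a \<in> int_grading R i" "y \<in> N" "y \<in> M h"
      by blast
    show ?case
    proof (cases "s = 0")
      case False
      then have "j = i + h"
        using scale(2) scale_closed_int[OF s(4,6)] s(1) direct_sum_disjoint[OF direct_sum] by blast
      then have "int l + h > e"
        using k scale(4) s(2) by linarith
      moreover have "scale b y \<in> N \<inter> M (int l + h)"
        using scale(3) s(5,6) scale_closed subspace_scale[OF graded_subspace[OF N]] by blast
      ultimately have "scale b y \<in> J \<odot> N"
        using J unfolding reduced_above_def by blast
      then have "scale a (scale b y) \<in> I \<odot> J \<odot> N"
        by (rule times_memI[OF s(3)])
      then show ?thesis
        unfolding s(1) by (simp add: times_left_commute[of I] mult.commute)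
    qed (simp add: subspace_0)
  qed (auto simp: subspace_0 subspace_add)
qed

lemma generated_upto_times:
  assumes I: "graded_ideal R I" "ring.generated_upto I r" and N: "graded_submodule scale M N" "generated_upto N e"
  shows "generated_upto (I \<odot> N) (r + e)"
proof -
  have "I \<odot> N = (\<Union>i\<in>{..r}. I \<inter> int_grading R i) \<odot> (\<Union>j\<in>{..e}. N \<inter> M j)"
    using ring.generated_upto_eq[OF I] generated_upto_eq[OF N] times_span_left times_span_right by metis
  also have "\<dots> \<subseteq> span (\<Union>j\<in>{..r + e}. I \<odot> N \<inter> M j)"
  proof (rule times_subsetI)
    fix a x assume "a \<in> (\<Union>i\<in>{..r}. I \<inter> int_grading R i)" "x \<in> (\<Union>j\<in>{..e}. N \<inter> M j)"
    then obtain i j where "i \<le> r" "j \<le> e" "a \<in> I" "a \<in> int_grading R i" "x \<in> N" "x \<in> M j"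
      by blast
    then have "i + j \<le> r + e" "scale a x \<in> I \<odot> N \<inter> M (i + j)"
      by (auto intro: times_memI scale_closed_int)
    then show "scale a x \<in> span (\<Union>j\<in>{..r + e}. I \<odot> N \<inter> M j)"
      by (intro span_base) blast
  qed simp
  finally show ?thesis
    by (simp add: generated_upto_def)
qed

text \<open>
  A form \<open>y\<close> of degree one is nilpotent on \<open>N' / J N'\<close>, so some power of it is congruent
  modulo \<open>J\<close> to an element annihilating \<open>N'\<close>, and hence \<open>N\<close>.
\<close>

lemma linear_reduction_transfer:
  assumes N: "graded_submodule scale M N" "generated_upto N e" and d: "\<forall>j<d. M j = {0}"
    and N': "graded_submodule scale M N'" "finite X" "N' = span X"
    and ann: "\<And>c. (\<forall>x\<in>N'. scale c x = 0) \<Longrightarrow> (\<forall>x\<in>N. scale c x = 0)"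
    and Y: "finite Y" "Y \<subseteq> R 1" "R 1 \<subseteq> ideal_span Y"
    and J: "linear_reduction scale R M N' J"
  shows "linear_reduction scale R M N J"
proof -
  have lin: "linear_ideal J"
    and "\<exists>e'. reduced_above N' J e'"
    using J linear_reduction_iff[OF graded_subspace[OF N'(1)]] by auto
  then obtain e' where e': "reduced_above N' J e'"
    by blast
  define A where "A = {a. \<forall>x\<in>N. scale a x \<in> J \<odot> N}"
  have idealA: "is_ideal A"
    unfolding A_def by (rule is_ideal_colon[OF subspace_times])
  have "\<exists>q. y ^ q \<in> A" if y: "y \<in> Y" for y
  proof -
    \<comment> \<open>Nonzero homogeneous elements of \<open>N'\<close> have degree at least
      \<open>d\<close>, so \<open>y ^ p\<close> moves them above degree \<open>e'\<close>, into
      \<open>J \<odot> N'\<close>.\<close>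
    define p where "p = nat (e' + 1 - d)"
    have yp: "y ^ q \<in> R q" for q
    proof (induct q)
      case 0
      show ?case using K_subring by (simp add: degree_zero is_subring_def)
    next
      case (Suc q)
      then show ?case
        using mult_closed[of y 1 "y ^ q" q] y Y(2) by auto
    qed
    have "subspace {x. scale (y ^ p) x \<in> J \<odot> N'}"
      by (rule subspace_preimage_scale[OF subspace_times])
    moreover have "scale (y ^ p) x \<in> J \<odot> N'" if x: "x \<in> N'" "x \<in> M j" for x j
    proof (cases "j < d")
      case True
      then show ?thesis
        using d x by (simp add: subspace_0)
    next
      case False
      then have "int p + j > e'"
        by (auto simp: p_def)
      then show ?thesis
        using e' x scale_closed[OF yp x(2)] subspace_scale[OF graded_subspace[OF N'(1)] x(1)]
        unfolding reduced_above_def by blast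
    qed
    ultimately have "span (N' \<inter> (\<Union>j. M j)) \<subseteq> {x. scale (y ^ p) x \<in> J \<odot> N'}"
      by (intro span_minimal) auto
    then have "scale (y ^ p) x \<in> J \<odot> X" if "x \<in> X" for x
      using graded_eq_span[OF N'(1)] that span_base[of x X] times_span_right N'(3) by blast
    from exists_annihilator_congruent_power[OF N'(2) is_ideal_linear_ideal[OF lin] this]
    obtain c n where c: "c - (y ^ p) ^ n \<in> J" "\<forall>x\<in>X. scale c x = 0"
      by blast
    have "N' \<subseteq> {x. scale c x = 0}"
      using c(2) unfolding N'(3) by (intro span_minimal subspace_annihilated) auto
    then have c0: "scale c x = 0" if "x \<in> N" for x
      using ann[of c] that by blast
    \<comment> \<open>On \<open>N\<close> the element \<open>c\<close> acts as zero, so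
      \<open>y ^ (p * n)\<close> acts as an element of \<open>J\<close>.\<close>
    have "scale (y ^ (p * n)) x \<in> J \<odot> N" if x: "x \<in> N" for x
    proof -
      have "scale (c - y ^ (p * n)) x \<in> J \<odot> N"
        using c(1) x by (intro times_memI) (simp_all add: power_mult)
      then have "- scale (y ^ (p * n)) x \<in> J \<odot> N"
        using c0[OF x] by (simp add: scale_left_diff_distrib)
      then show ?thesis
        using subspace_neg[OF subspace_times] by fastforce
    qed
    then show ?thesis
      by (auto simp: A_def)
  qed
  from eventually_subset_if_powers_mem[OF idealA Y this]
  obtain m0 where m0: "\<And>m. m \<ge> m0 \<Longrightarrow> R m \<subseteq> A"
    by blast
  \<comment> \<open>Generators of degree at most \<open>e\<close> need coefficients of degree at
    least \<open>m0\<close> to reach this range, and those lie in \<open>A\<close>.\<close>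
  have "reduced_above N J (e + int m0)"
    unfolding reduced_above_def
  proof (intro allI impI subsetI)
    fix k x assume k: "e + int m0 < k" and "x \<in> N \<inter> M k"
    then have "x \<in> span (\<Union>j\<in>{..e}. N \<inter> M j)" "x \<in> M k" "(\<Union>j\<in>{..e}. N \<inter> M j) \<subseteq> (\<Union>j. M j)"
      using generated_upto_eq[OF N] by auto
    then show "x \<in> J \<odot> N"
    proof (induct rule: homogeneous_in_span_induct)
      case (scale s j a i)
      then obtain j' where j': "j' \<le> e" "s \<in> N" "s \<in> M j'"
        by auto
      show ?case
      proof (cases "s = 0")
        case False
        then have "j' = j"
          using scale(2) j'(3) direct_sum_disjoint[OF direct_sum] by blast
        then have "i \<ge> m0"
          using j'(1) scale(4) k by linarith
        then show ?thesis
          using m0 scale(3) j'(2) by (auto simp: A_def)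
      qed (simp add: subspace_0)
    qed (auto simp: subspace_0 subspace_add)
  qed
  then show ?thesis
    using lin linear_reduction_iff[OF graded_subspace[OF N(1)]] by blast
qed

end

section \<open>Minimal linear reductions\<close>

context module
begin

text \<open>Each element of \<open>B\<close> involves only finitely many elements of
  \<open>S\<close>. This allows ideal generators to be chosen among the linear forms.\<close>

lemma finite_generating_subset:
  assumes "finite B" "span S = span B"
  shows "\<exists>T. finite T \<and> T \<subseteq> S \<and> span T = span S"
proof -
  have "\<exists>T. finite T \<and> T \<subseteq> S \<and> b \<in> span T" if "b \<in> B" for b
  proof -
    have "b \<in> span S"
      using that assms(2) span_base by blast
    then obtain t r where "finite t" "t \<subseteq> S" "b = (\<Sum>a\<in>t. scale (r a) a)"
      unfolding span_explicit by blast
    then show ?thesis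
      by (intro exI[of _ t]) (auto intro!: span_sum span_scale intro: span_base)
  qed
  then obtain T where T: "\<And>b. b \<in> B \<Longrightarrow> finite (T b) \<and> T b \<subseteq> S \<and> b \<in> span (T b)"
    by metis
  have "B \<subseteq> span (\<Union>(T ` B))"
    using T span_mono[of _ "\<Union>(T ` B)"] by blast
  then have "span S \<subseteq> span (\<Union>(T ` B))"
    unfolding assms(2) by (intro span_minimal) auto
  moreover have "span (\<Union>(T ` B)) \<subseteq> span S"
    using T by (intro span_mono) auto
  ultimately show ?thesis
    using T assms(1) by (intro exI[of _ "\<Union>(T ` B)"]) auto
qed

end

text \<open>
  \<open>leading_count K V [y\<^sub>1, ..., y\<^sub>s]\<close> is the dimension of \<open>V\<close> when \<open>V\<close> lies in the
  \<open>K\<close>-span of the \<open>y\<^sub>i\<close>: it counts the steps of the flag of \<open>K\<close>-spans of the tails of the list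
  at which the intersection with \<open>V\<close> grows.
\<close>

fun flag :: "'a::comm_ring_1 set \<Rightarrow> 'a list \<Rightarrow> 'a set" where
  "flag K [] = {0}"
| "flag K (y # ys) = {c * y + w | c w. c \<in> K \<and> w \<in> flag K ys}"

fun leading_count :: "'a::comm_ring_1 set \<Rightarrow> 'a set \<Rightarrow> 'a list \<Rightarrow> nat" where
  "leading_count K V [] = 0"
| "leading_count K V (y # ys) =
    (if \<exists>v\<in>V. v - y \<in> flag K ys then 1 else 0) + leading_count K V ys"

lemma leading_count_mono: "V' \<subseteq> V \<Longrightarrow> leading_count K V' ys \<le> leading_count K V ys"
  by (induct ys) auto

context standard_graded_algebra
begin

lemma K_closed:
  "0 \<in> K" "1 \<in> K" "x \<in> K \<Longrightarrow> y \<in> K \<Longrightarrow> x - y \<in> K" "x \<in> K \<Longrightarrow> y \<in> K \<Longrightarrow> x + y \<in> K"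
  "x \<in> K \<Longrightarrow> y \<in> K \<Longrightarrow> x * y \<in> K"
  using K_subring direct_sum_zero[OF direct_sum, of 0] direct_sum_add[OF direct_sum, of x 0 y]
  by (auto simp: is_subring_def degree_zero)

lemma flag_closed:
  "0 \<in> flag K ys" "x \<in> flag K ys \<Longrightarrow> y \<in> flag K ys \<Longrightarrow> x + y \<in> flag K ys"
  "c \<in> K \<Longrightarrow> x \<in> flag K ys \<Longrightarrow> c * x \<in> flag K ys"
proof -
  show "0 \<in> flag K ys"
    by (induct ys) (auto intro: exI[of _ 0] simp: K_closed)
  show "x \<in> flag K ys \<Longrightarrow> y \<in> flag K ys \<Longrightarrow> x + y \<in> flag K ys"
  proof (induct ys arbitrary: x y)
    case (Cons z ys)
    then obtain a b v w where "a \<in> K" "b \<in> K" "v \<in> flag K ys" "w \<in> flag K ys" "x = a * z + v" "y = b * z + w"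
      by auto
    moreover from this have "x + y = (a + b) * z + (v + w)"
      by (simp add: distrib_right)
    ultimately show ?case
      using Cons(1) K_closed(4) unfolding flag.simps by blast
  qed simp
  show "c \<in> K \<Longrightarrow> x \<in> flag K ys \<Longrightarrow> c * x \<in> flag K ys"
  proof (induct ys arbitrary: x)
    case (Cons z ys)
    then obtain a v where "a \<in> K" "v \<in> flag K ys" "x = a * z + v"
      by auto
    moreover from this have "c * x = (c * a) * z + c * v"
      by (simp add: distrib_left)
    ultimately show ?case
      using Cons(1,2) K_closed(5) unfolding flag.simps by blast
  qed simp
qed

text \<open>A subspace of at least the same dimension is the whole space. Closure under
  \<open>v - c * w\<close> encodes \<open>K\<close>-subspaces; the proof is Gaussian elimination
  along the flag.\<close>

lemma subset_if_leading_count_le: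
  assumes V: "0 \<in> V" "\<And>v w c. v \<in> V \<Longrightarrow> w \<in> V \<Longrightarrow> c \<in> K \<Longrightarrow> v - c * w \<in> V"
    and V': "0 \<in> V'" "\<And>v w c. v \<in> V' \<Longrightarrow> w \<in> V' \<Longrightarrow> c \<in> K \<Longrightarrow> v - c * w \<in> V'"
    and "V' \<subseteq> V" "leading_count K V ys \<le> leading_count K V' ys"
  shows "V \<inter> flag K ys \<subseteq> V'"
  using assms(6)
proof (induct ys)
  case Nil
  then show ?case
    using V'(1) by auto
next
  case (Cons y ys)
  have le: "leading_count K V' ys \<le> leading_count K V ys"
    by (rule leading_count_mono[OF assms(5)])
  with Cons(2) have "leading_count K V ys \<le> leading_count K V' ys"
    using assms(5) by (auto split: if_splits)
  then have IH: "V \<inter> flag K ys \<subseteq> V'"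
    by (rule Cons(1))
  \<comment> \<open>The tail counts already satisfy \<open>le\<close>, so a step that counts for
    \<open>V\<close> must count for \<open>V'\<close> too.\<close>
  have lead: "\<exists>v\<in>V'. v - y \<in> flag K ys" if "\<exists>v\<in>V. v - y \<in> flag K ys"
    using Cons(2) that le by (auto split: if_splits)
  show ?case
  proof
    fix v assume "v \<in> V \<inter> flag K (y # ys)"
    then obtain c w where v: "v \<in> V" "v = c * y + w" "c \<in> K" "w \<in> flag K ys"
      by auto
    show "v \<in> V'"
    proof (cases "c = 0")
      case True
      then show ?thesis
        using v IH by auto
    next
      case False
      then obtain d where d: "d \<in> K" "c * d = 1"
        using field v(3) by (auto simp: is_subfield_def)
      have "0 - d \<in> K"
        by (rule K_closed(3)[OF K_closed(1) d(1)])
      \<comment> \<open>This is \<open>d * v\<close>, with leading coefficient one, written in the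
        form to which the closure property applies.\<close>
      then have "0 - (0 - d) * v \<in> V"
        by (rule V(2)[OF V(1) v(1)])
      moreover have "0 - (0 - d) * v - y = d * w"
        using d(2) unfolding v(2) by (simp add: distrib_left mult.commute)
      ultimately obtain v' where v': "v' \<in> V'" "v' - y \<in> flag K ys"
        using lead flag_closed(3)[OF d(1) v(4)] by metis
      \<comment> \<open>Subtracting \<open>c * v'\<close> cancels the leading term and leaves an
        element of the tail, where the induction hypothesis applies.\<close>
      have "v - c * v' = w + (0 - c) * (v' - y)"
        unfolding v(2) by (simp add: right_diff_distrib)
      also have "\<dots> \<in> flag K ys"
        by (intro flag_closed v K_closed v')
      finally have "v - c * v' \<in> V'"
        using IH V(2)[OF v(1) _ v(3)] v'(1) assms(5) by blast
      moreover have "v = (v - c * v') - (0 - c) * v'"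
        by simp
      ultimately show ?thesis
        using V'(2)[OF _ v'(1) K_closed(3)[OF K_closed(1) v(3)]] by metis
    qed
  qed
qed

text \<open>In degree one, coefficients of linear generators may be taken from \<open>R 0\<close>,
  which is \<open>K\<close>.\<close>

lemma linear_forms_subset_flag:
  assumes "set ys \<subseteq> R 1" "R 1 \<subseteq> ideal_span (set ys)"
  shows "R 1 \<subseteq> flag K ys"
proof
  fix x assume "x \<in> R 1"
  then have "x \<in> R (Suc 0)"
    by simp
  then show "x \<in> flag K ys"
  proof (rule linear_span_induct_step[OF assms])
    fix a y assume "a \<in> R 0" "y \<in> set ys"
    then show "a * y \<in> flag K ys"
    proof (induct ys)
      case (Cons z ys)
      show ?case
      proof (cases "y = z")
        case True
        then show ?thesis
          using Cons(2) flag_closed(1) by (force simp: degree_zero)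
      next
        case False
        then have "a * y = 0 * z + a * y" "a * y \<in> flag K ys"
          using Cons by auto
        then show ?thesis
          using K_closed(1) unfolding flag.simps by blast
      qed
    qed simp
  qed (auto intro: flag_closed)
qed

end

section \<open>Existence of minimal linear reductions\<close>

context graded_algebra_module
begin

text \<open>Choose \<open>J\<close> with \<open>J \<inter> R 1\<close> of least dimension. A
  reduction inside \<open>J\<close> then has the same linear forms, and these generate
  \<open>J\<close>.\<close>

lemma exists_minimal_linear_reduction:
  assumes N: "graded_submodule scale M N" "generated_upto N e"
    and Y: "finite Y" "Y \<subseteq> R 1" "R 1 \<subseteq> ideal_span Y"
  shows "\<exists>J. minimal_linear_reduction scale R M N J"
proof -
  obtain ys where ys: "set ys = Y"
    using finite_list[OF Y(1)] by blast
  have flag: "R 1 \<subseteq> flag K ys"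
    using linear_forms_subset_flag[of ys] Y ys by simp
  let ?f = "\<lambda>J. leading_count K (J \<inter> R 1) ys"
  obtain J where J: "linear_reduction scale R M N J"
    and least: "\<And>J'. linear_reduction scale R M N J' \<Longrightarrow> ?f J \<le> ?f J'"
    using ex_has_least_nat[of "linear_reduction scale R M N" _ ?f] linear_reduction_irrelevant[OF N]
    by blast
  have "J' = J" if J': "linear_reduction scale R M N J'" "J' \<subseteq> J" for J'
  proof -
    have lin: "linear_ideal J" "linear_ideal J'"
      using J J'(1) linear_reduction_iff[OF graded_subspace[OF N(1)]] by auto
    have closed: "0 \<in> P \<inter> R 1 \<and> (\<forall>v\<in>P \<inter> R 1. \<forall>w\<in>P \<inter> R 1. \<forall>c\<in>K. v - c * w \<in> P \<inter> R 1)"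
      if "linear_ideal P" for P
    proof (intro conjI ballI)
      note P = is_ideal_linear_ideal[OF that]
      show "0 \<in> P \<inter> R 1"
        using ring.subspace_0[OF P] direct_sum_zero[OF alg.direct_sum] by blast
      fix v w c assume vw: "v \<in> P \<inter> R 1" "w \<in> P \<inter> R 1" "c \<in> K"
      have "c * w \<in> R 1"
        using mult_closed[of c 0 w 1] vw by (simp add: degree_zero)
      moreover have "c * w \<in> P"
        using ring.subspace_scale[OF P] vw by blast
      ultimately show "v - c * w \<in> P \<inter> R 1"
        using ring.subspace_diff[OF P] direct_sum_diff[OF alg.direct_sum] vw by blast
    qed
    have "(J \<inter> R 1) \<inter> flag K ys \<subseteq> J' \<inter> R 1"
      using closed[OF lin(1)] closed[OF lin(2)] least[OF J'(1)] J'(2)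
      by (intro subset_if_leading_count_le) auto
    then have "J \<inter> R 1 \<subseteq> J'"
      using flag by blast
    moreover obtain L where L: "L \<subseteq> R 1" "J = ideal_span L"
      using lin(1) by (auto simp: linear_ideal_def)
    moreover have "L \<subseteq> J"
      using L(2) ring.span_superset by blast
    ultimately have "J \<subseteq> J'"
      using ring.span_minimal[OF _ is_ideal_linear_ideal[OF lin(2)]] by blast
    then show ?thesis
      using J'(2) by blast
  qed
  then show ?thesis
    using J unfolding minimal_linear_reduction_def by blast
qed

text \<open>Every \<open>r_J(N)\<close> is at least \<open>D(N)\<close>, hence at least
  \<open>d\<close>, so the \<open>LEAST\<close> over the nonempty set of minimal reductions is
  attained.\<close>

lemma reduction_number_props:
  assumes N: "graded_submodule scale M N" "generated_upto N e" "N \<noteq> {0}"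
    and d: "\<forall>j<d. M j = {0}"
    and Y: "finite Y" "Y \<subseteq> R 1" "R 1 \<subseteq> ideal_span Y"
  shows "\<exists>J. minimal_linear_reduction scale R M N J \<and>
      reduction_number scale R M N = reduction_number_wrt scale M N J"
    and "minimal_linear_reduction scale R M N J \<Longrightarrow>
      reduction_number scale R M N \<le> reduction_number_wrt scale M N J"
proof -
  let ?P = "\<lambda>r. \<exists>J. minimal_linear_reduction scale R M N J \<and> r = reduction_number_wrt scale M N J"
  have bound: "d \<le> r" if "?P r" for r
    using that reduction_number_wrt_props(3)[OF N(1,3) d N(2)] max_gen_degree_props(4)[OF N(1) d N(2,3)]
    by (force simp: minimal_linear_reduction_def)
  have "\<exists>r. ?P r"
    using exists_minimal_linear_reduction[OF N(1,2) Y] by blast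
  then obtain r where "?P r" ..
  note least = int_Least[where P = ?P, OF this bound, folded reduction_number_def]
  show "\<exists>J. minimal_linear_reduction scale R M N J \<and>
      reduction_number scale R M N = reduction_number_wrt scale M N J"
    using least(1) by blast
  show "minimal_linear_reduction scale R M N J \<Longrightarrow>
      reduction_number scale R M N \<le> reduction_number_wrt scale M N J"
    using least(2) by blast
qed

end

section \<open>Powers of an ideal\<close>

locale noetherian_graded_module = graded_algebra_module K R scale M
  for K :: "'a::comm_ring_1 set" and R :: "nat \<Rightarrow> 'a set"
    and scale :: "'a \<Rightarrow> 'm::ab_group_add \<Rightarrow> 'm" and M :: "int \<Rightarrow> 'm set" +
  assumes noetherian: "is_ideal (A :: 'a set) \<Longrightarrow> \<exists>B. finite B \<and> A = ideal_span B"
    and finitely_generated: "\<exists>B. finite B \<and> span B = UNIV"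
    and nonzero: "(UNIV :: 'm set) \<noteq> {0}"
begin

lemma exists_linear_generators:
  obtains Y where "finite Y" "Y \<subseteq> R 1" "R 1 \<subseteq> ideal_span Y"
proof -
  obtain B where "finite B" "ideal_span (R 1) = ideal_span B"
    using noetherian[OF ring.subspace_span] by metis
  then obtain Y where "finite Y" "Y \<subseteq> R 1" "ideal_span Y = ideal_span (R 1)"
    using ring.finite_generating_subset[of B "R 1"] by metis
  then show ?thesis
    using that[of Y] ring.span_superset[of "R 1"] by simp
qed

text \<open>Scalars never lower degrees, so the least degree of a component of a generator is a
  bound.\<close>

lemma exists_degree_lower_bound: "\<exists>d. \<forall>j<d. M j = {0}"
proof -
  obtain B where B: "finite B" "span B = UNIV"
    using finitely_generated by blast
  define A where "A = (\<Union>b\<in>B. {i. component M b i \<noteq> 0})"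
  have "finite A"
    using B(1) finite_support_component[OF direct_sum] by (auto simp: A_def)
  then obtain d where d: "\<And>i. i \<in> A \<Longrightarrow> d \<le> i"
    by (meson Min_le)
  let ?S = "\<Union>j\<in>{d..}. M j"
  have "b \<in> span ?S" if "b \<in> B" for b
  proof -
    have "(\<Sum>i | component M b i \<noteq> 0. component M b i) \<in> span ?S"
      using d that component_mem[OF direct_sum] by (intro span_sum span_base) (auto simp: A_def)
    then show ?thesis
      by (simp add: sum_component[OF direct_sum])
  qed
  then have "span B \<subseteq> span ?S"
    by (intro span_minimal) auto
  then have top: "x \<in> span ?S" for x
    using B(2) by auto
  have "x = 0" if "j < d" "x \<in> M j" for j x
  proof -
    have "x \<in> span ?S" "x \<in> M j" "?S \<subseteq> (\<Union>j. M j)"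
      using top that by auto
    then show ?thesis
    proof (induct rule: homogeneous_in_span_induct)
      case (scale s h a i)
      then obtain h' where h': "d \<le> h'" "s \<in> M h'"
        by auto
      \<comment> \<open>Here \<open>h\<close> is at most \<open>j\<close>, hence below
        \<open>d\<close>, while \<open>h'\<close> is at least \<open>d\<close>; so \<open>s\<close>
        lies in two degrees and vanishes.\<close>
      then have "h' \<noteq> h"
        using scale(4) that(1) by linarith
      then have "s = 0"
        using h'(2) scale(2) direct_sum_disjoint[OF direct_sum] by blast
      then show ?case
        by simp
    qed auto
  qed
  then show ?thesis
    using M_zero by blast
qed

lemma below_min_degree:
  assumes "j < min_degree M UNIV"
  shows "M j = {0}"
proof -
  let ?P = "\<lambda>n. UNIV \<inter> M n \<noteq> {0}"
  obtain d where d: "\<forall>j<d. M j = {0}"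
    using exists_degree_lower_bound by blast
  have "\<exists>n. ?P n"
  proof (rule ccontr)
    assume "\<nexists>n. ?P n"
    then have "(\<Union>j. M j) \<subseteq> {0}"
      by auto
    then have "span (UNIV \<inter> (\<Union>j. M j)) \<subseteq> {0}"
      by (intro span_minimal) auto
    then show False
      using graded_eq_span[OF graded_UNIV] nonzero by auto
  qed
  then obtain n where "?P n" ..
  moreover have "d \<le> y" if "?P y" for y
    using that d by (cases "y < d") auto
  ultimately show ?thesis
    using int_Least(2)[where P = ?P and y = j, folded min_degree_def] assms by fastforce
qed

lemma exists_ideal_generated_upto: "graded_ideal R J \<Longrightarrow> \<exists>e. ring.generated_upto J e"
  using noetherian[OF ring.graded_subspace] ring.exists_generated_upto by metis

section \<open>The modules obtained from the powers of \<open>I\<close>\<close>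

context
  fixes I :: "'a set"
  assumes I: "graded_ideal R I"
begin

abbreviation power_times :: "nat \<Rightarrow> 'm set" where
  "power_times n \<equiv> ideal_power I n \<odot> UNIV"

lemma power_times_0: "power_times 0 = UNIV"
  using times_memI[of 1 UNIV _ UNIV] by auto

lemma power_times_Suc: "power_times (Suc n) = I \<odot> power_times n"
  by (simp add: times_assoc)

lemma graded_power_times: "graded_submodule scale M (power_times n)"
proof (induct n)
  case 0
  show ?case
    unfolding power_times_0 by (rule graded_UNIV)
next
  case (Suc n)
  then show ?case
    unfolding power_times_Suc by (rule graded_times[OF I])
qed

lemma power_times_Suc_subset: "power_times (Suc n) \<subseteq> power_times n"
  unfolding power_times_Suc by (rule times_subset[OF graded_subspace[OF graded_power_times]])

lemma finitely_generated_power_times: "\<exists>X. finite X \<and> power_times n = span X"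
proof (induct n)
  case 0
  show ?case
    unfolding power_times_0 using finitely_generated by metis
next
  case (Suc n)
  moreover obtain A where "finite A" "I = ideal_span A"
    using noetherian[OF ring.graded_subspace[OF I]] by blast
  ultimately show ?case
    unfolding power_times_Suc using finitely_generated_times by blast
qed

lemma exists_generated_upto_power_times: "\<exists>e. generated_upto (power_times n) e"
  using exists_generated_upto[OF graded_power_times] finitely_generated_power_times by blast

text \<open>The modules descend, so their annihilators ascend; their union is a finitely generated
  ideal and is reached at a finite stage.\<close>

lemma annihilator_stabilises:
  "\<exists>n0. \<forall>n\<ge>n0. \<forall>c. (\<forall>x\<in>power_times (Suc n). scale c x = 0) \<longrightarrow> (\<forall>x\<in>power_times n. scale c x = 0)"
proof -
  define A where "A n = {c. \<forall>x\<in>power_times n. scale c x \<in> {0}}" for n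
  have ideal: "is_ideal (A n)" for n
    unfolding A_def by (rule is_ideal_colon[OF subspace_single_0])
  have mono: "A n \<subseteq> A n'" if "n \<le> n'" for n n'
    using _ that
  proof (rule lift_Suc_mono_le)
    show "A k \<subseteq> A (Suc k)" for k
      using power_times_Suc_subset[of k] unfolding A_def by blast
  qed
  have "is_ideal (\<Union>n. A n)"
  proof (rule ring.subspaceI)
    show "0 \<in> (\<Union>n. A n)"
      using ring.subspace_0[OF ideal] by blast
    fix x y assume "x \<in> (\<Union>n. A n)" "y \<in> (\<Union>n. A n)"
    then obtain n k where "x \<in> A n" "y \<in> A k"
      by blast
    then have "x \<in> A (max n k)" "y \<in> A (max n k)"
      using mono[of n "max n k"] mono[of k "max n k"] by auto
    then show "x + y \<in> (\<Union>n. A n)"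
      using ring.subspace_add[OF ideal] by blast
  next
    fix c x assume "x \<in> (\<Union>n. A n)"
    then show "c * x \<in> (\<Union>n. A n)"
      using ring.subspace_scale[OF ideal] by blast
  qed
  from noetherian[OF this] obtain B where B: "finite B" "(\<Union>n. A n) = ideal_span B"
    by blast
  then have "\<forall>b\<in>B. \<exists>n. b \<in> A n"
    using ring.span_superset[of B] by blast
  then obtain f where f: "\<And>b. b \<in> B \<Longrightarrow> b \<in> A (f b)"
    by metis
  \<comment> \<open>\<open>sum f B\<close> serves as a common upper bound of the indices
    \<open>f b\<close>.\<close>
  have "B \<subseteq> A (sum f B)"
    using f mono[OF member_le_sum[of _ B f]] B(1) by blast
  then have "ideal_span B \<subseteq> A (sum f B)"
    by (rule ring.span_minimal[OF _ ideal])
  then have "A (Suc n) \<subseteq> A n" if "n \<ge> sum f B" for n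
    using B(2) mono[OF that] by blast
  then show ?thesis
    by (intro exI[of _ "sum f B"]) (auto simp: A_def)
qed

text \<open>In a term \<open>a y\<close> either \<open>a\<close> has degree below \<open>r\<close>,
  or removing \<open>a\<close> lowers the degree by at least \<open>r\<close> and \<open>low\<close>
  applies.\<close>

lemma low_degree_step:
  assumes low: "\<And>a y h. a \<in> I \<Longrightarrow> y \<in> power_times n \<Longrightarrow> y \<in> M h \<Longrightarrow> h < r * int n + d \<Longrightarrow>
      scale a y \<in> (\<Union>i\<in>{..<r}. I \<inter> int_grading R i) \<odot> power_times n"
    and k: "k < r * int (Suc n) + d"
  shows "power_times (Suc n) \<inter> M k \<subseteq> (\<Union>i\<in>{..<r}. I \<inter> int_grading R i) \<odot> power_times n"
proof
  fix x assume x: "x \<in> power_times (Suc n) \<inter> M k"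
  obtain b where b: "ring.generated_upto I b"
    using exists_ideal_generated_upto[OF I] by blast
  let ?S = "{scale a x | a x i h. i \<le> b \<and> a \<in> I \<inter> int_grading R i \<and> x \<in> power_times n \<inter> M h}"
  have "x \<in> span ?S" "x \<in> M k" "?S \<subseteq> (\<Union>j. M j)"
    using x times_generated_upto[OF I b graded_power_times, of n] unfolding power_times_Suc
    by (auto intro: scale_closed_int)
  then show "x \<in> (\<Union>i\<in>{..<r}. I \<inter> int_grading R i) \<odot> power_times n"
  proof (induct rule: homogeneous_in_span_induct)
    case (scale s j c l)
    then obtain a y i h where s: "s = scale a y" "a \<in> I" "a \<in> int_grading R i"
      "y \<in> power_times n" "y \<in> M h"
      by blast
    have "s \<in> (\<Union>i\<in>{..<r}. I \<inter> int_grading R i) \<odot> power_times n"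
    proof (cases "s = 0 \<or> i < r")
      case True
      then show ?thesis
        using s by (auto intro: times_memI simp: subspace_0)
    next
      case False
      then have "j = i + h"
        using scale(2) scale_closed_int[OF s(3,5)] s(1) direct_sum_disjoint[OF direct_sum] by blast
      then have "h < r * int n + d"
        using k scale(4) False by (simp add: distrib_left)
      then show ?thesis
        using low s by blast
    qed
    then show ?case
      by (rule subspace_scale[OF subspace_times])
  qed (auto simp: subspace_0 subspace_add)
qed

text \<open>
  In a product \<open>a\<^sub>1 \<cdots> a\<^sub>n\<^sub>+\<^sub>1 x\<close> of degree less than \<open>(n + 1) r + d\<close> some factor \<open>a\<^sub>i\<close> has degree
  less than \<open>r\<close>.
\<close>

lemma low_degree_part_in_times:
  assumes d: "\<forall>j<d. M j = {0}"
  shows "k < r * int (Suc n) + d \<Longrightarrow>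
    power_times (Suc n) \<inter> M k \<subseteq> (\<Union>i\<in>{..<r}. I \<inter> int_grading R i) \<odot> power_times n"
proof (induct n arbitrary: k)
  case 0
  \<comment> \<open>For \<open>n = 0\<close> the remaining factor has degree below \<open>d\<close>
    and is zero.\<close>
  then show ?case
    by (intro low_degree_step) (use d in \<open>auto simp: subspace_0\<close>)
next
  case (Suc n)
  then show ?case
  proof (intro low_degree_step)
    fix a y h assume "a \<in> I" "y \<in> power_times (Suc n)" "y \<in> M h" "h < r * int (Suc n) + d"
    \<comment> \<open>By the induction hypothesis \<open>y\<close> already contains a factor of low
      degree; commuting it to the front lets \<open>I\<close> be absorbed into the next
      power.\<close>
    then have "scale a y \<in> I \<odot> (\<Union>i\<in>{..<r}. I \<inter> int_grading R i) \<odot> power_times n"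
      using Suc(1)[of h] by (intro times_memI) auto
    then show "scale a y \<in> (\<Union>i\<in>{..<r}. I \<inter> int_grading R i) \<odot> power_times (Suc n)"
      unfolding power_times_Suc by (simp only: times_left_commute)
  qed
qed

end

end

section \<open>The number \<open>rho\<close> and the asymptotic formula\<close>

context noetherian_graded_module
begin

context
  fixes I :: "'a set"
  assumes I: "graded_ideal R I" and nonzero_powers: "\<And>n. power_times I n \<noteq> {0}"
begin

text \<open>The zero ideal is not a reduction because no power of \<open>I\<close> annihilates the
  module. So \<open>D(J)\<close> is a genuine maximum, and it is nonnegative.\<close>

lemma reduction_of_ideal_degree:
  assumes "reduction_of_ideal scale R I J"
  shows "graded_ideal R J" "ring.generated_upto J (max_gen_degree (*) R (int_grading R) J)"
    and "0 \<le> max_gen_degree (*) R (int_grading R) J"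
    and "ring.generated_upto J e \<Longrightarrow> max_gen_degree (*) R (int_grading R) J \<le> e"
proof -
  show J: "graded_ideal R J"
    using assms by (simp add: reduction_of_ideal_def)
  have "J \<noteq> {0}"
  proof
    assume "J = {0}"
    obtain n where "J \<odot> power_times I n = power_times I (n + 1)"
      using assms by (auto simp: reduction_of_ideal_def)
    moreover have "J \<odot> power_times I n \<subseteq> {0}"
      using \<open>J = {0}\<close> by (intro times_subsetI) auto
    ultimately show False
      using nonzero_powers[of "n + 1"] subspace_0[OF subspace_times[of "ideal_power I (n + 1)" UNIV]]
      by auto
  qed
  obtain b where b: "ring.generated_upto J b"
    using exists_ideal_generated_upto[OF J] by blast
  show "ring.generated_upto J (max_gen_degree (*) R (int_grading R) J)"
    using ring.max_gen_degree_props(1)[OF J int_grading_vanishes b \<open>J \<noteq> {0}\<close>] .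
  show "0 \<le> max_gen_degree (*) R (int_grading R) J"
    using ring.max_gen_degree_props(4)[OF J int_grading_vanishes b \<open>J \<noteq> {0}\<close>] .
  show "max_gen_degree (*) R (int_grading R) J \<le> e" if "ring.generated_upto J e"
    using ring.max_gen_degree_props(2)[OF J int_grading_vanishes that \<open>J \<noteq> {0}\<close>] .
qed

text \<open>\<open>I\<close> is a reduction of itself and the degrees \<open>D(J)\<close> are
  nonnegative, so the minimum is attained.\<close>

lemma rho_props:
  shows "\<exists>J. reduction_of_ideal scale R I J \<and> rho scale R I = max_gen_degree (*) R (int_grading R) J"
    and "reduction_of_ideal scale R I J \<Longrightarrow> rho scale R I \<le> max_gen_degree (*) R (int_grading R) J"
proof -
  let ?P = "\<lambda>d. \<exists>J. reduction_of_ideal scale R I J \<and> d = max_gen_degree (*) R (int_grading R) J"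
  have "I \<odot> power_times I 1 = power_times I (1 + 1)"
    using power_times_Suc[OF I, of 1] by simp
  then have "reduction_of_ideal scale R I I"
    using I unfolding reduction_of_ideal_def by (intro conjI exI[of _ 1]) auto
  then have "\<exists>d. ?P d"
    by blast
  then obtain d where "?P d" ..
  moreover have "0 \<le> d" if "?P d" for d
    using that reduction_of_ideal_degree(3) by blast
  ultimately have least: "?P (rho scale R I)" "\<And>y. ?P y \<Longrightarrow> rho scale R I \<le> y"
    using int_Least[where P = ?P and b = 0, folded rho_def] by blast+
  show "\<exists>J. reduction_of_ideal scale R I J \<and> rho scale R I = max_gen_degree (*) R (int_grading R) J"
    by (rule least(1))
  show "reduction_of_ideal scale R I J \<Longrightarrow> rho scale R I \<le> max_gen_degree (*) R (int_grading R) J"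
    using least(2) by blast
qed

lemma rho_lower_bound:
  assumes d: "\<forall>j<d. M j = {0}" and "n > 0" "generated_upto (power_times I (Suc n)) e"
  shows "rho scale R I * int (Suc n) + d \<le> e"
proof (rule ccontr)
  let ?r = "rho scale R I"
  assume low: "\<not> ?r * int (Suc n) + d \<le> e"
  \<comment> \<open>If \<open>e\<close> were smaller, all generators of the module would have low
    degree in the sense of \<open>low_degree_part_in_times\<close>, so these forms would generate a
    reduction.\<close>
  define A where "A = (\<Union>i\<in>{..<?r}. I \<inter> int_grading R i)"
  have "A \<subseteq> (\<Union>i. int_grading R i)" "A \<subseteq> I"
    by (auto simp: A_def)
  have J: "graded_ideal R (ideal_span A)"
    by (rule ring.graded_span) fact
  have JI: "ideal_span A \<subseteq> I"
    by (rule ring.span_minimal[OF \<open>A \<subseteq> I\<close> ring.graded_subspace[OF I]])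
  have "ideal_span A \<odot> power_times I n = power_times I (n + 1)"
  proof
    show "ideal_span A \<odot> power_times I n \<subseteq> power_times I (n + 1)"
      using JI by (simp only: Suc_eq_plus1[symmetric] power_times_Suc[OF I] times_mono order_refl)
    have "power_times I (Suc n) \<inter> M k \<subseteq> A \<odot> power_times I n" if "k \<le> e" for k
      unfolding A_def using low_degree_part_in_times[OF I d, where k = k and r = ?r and n = n] low that
      by linarith
    then have "(\<Union>j\<in>{..e}. power_times I (Suc n) \<inter> M j) \<subseteq> ideal_span A \<odot> power_times I n"
      by (auto simp: times_span_left)
    then have "span (\<Union>j\<in>{..e}. power_times I (Suc n) \<inter> M j) \<subseteq> ideal_span A \<odot> power_times I n"
      by (rule span_minimal) (rule subspace_times)
    then show "power_times I (n + 1) \<subseteq> ideal_span A \<odot> power_times I n"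
      using assms(3) by (auto simp: generated_upto_def)
  qed
  then have red: "reduction_of_ideal scale R I (ideal_span A)"
    unfolding reduction_of_ideal_def using J JI \<open>n > 0\<close> by blast
  \<comment> \<open>Degrees strictly below \<open>?r\<close> are at most \<open>?r - 1\<close>,
    which contradicts the minimality of \<open>?r\<close>.\<close>
  have "ring.generated_upto (ideal_span A) (?r - 1)"
    unfolding ring.generated_upto_def A_def
    by (rule ring.span_mono) (force intro: ring.span_base)
  from reduction_of_ideal_degree(4)[OF red this] rho_props(2)[OF red] show False
    by simp
qed

lemma asymptotic_linearity:
  "\<exists>\<epsilon>\<^sub>1 \<epsilon>\<^sub>2 :: int. \<epsilon>\<^sub>1 \<ge> \<epsilon>\<^sub>2 \<and> \<epsilon>\<^sub>2 \<ge> min_degree M UNIV \<and>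
    (\<forall>\<^sub>F n in sequentially.
       reduction_number scale R M (power_times I n) = rho scale R I * int n + \<epsilon>\<^sub>1 \<and>
       max_gen_degree scale R M (power_times I n) = rho scale R I * int n + \<epsilon>\<^sub>2)"
proof -
  let ?N = "power_times I"
  define d where "d = min_degree M UNIV"
  define r where "r = rho scale R I"
  have d: "\<forall>j<d. M j = {0}"
    using below_min_degree by (simp add: d_def)
  obtain Y where Y: "finite Y" "Y \<subseteq> R 1" "R 1 \<subseteq> ideal_span Y"
    using exists_linear_generators by blast
  note N = graded_power_times[OF I]
  obtain e where e: "\<And>n. generated_upto (?N n) (e n)"
    using exists_generated_upto_power_times[OF I] by metis
  obtain J0 where J0: "reduction_of_ideal scale R I J0" "r = max_gen_degree (*) R (int_grading R) J0"
    using rho_props(1) by (auto simp: r_def)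
  then have gJ0: "graded_ideal R J0" "ring.generated_upto J0 r"
    using reduction_of_ideal_degree(1,2)[OF J0(1)] by auto
  obtain m where m: "J0 \<odot> ?N m = ?N (Suc m)"
    using J0(1) by (auto simp: reduction_of_ideal_def)
  \<comment> \<open>Multiplying the equality at \<open>m\<close> by \<open>I\<close> propagates it
    to all larger \<open>n\<close>.\<close>
  have J0N: "J0 \<odot> ?N n = ?N (Suc n)" if "n \<ge> m" for n
    using that
  proof (induct n rule: dec_induct)
    case (step n)
    have "J0 \<odot> ?N (Suc n) = I \<odot> J0 \<odot> ?N n"
      unfolding power_times_Suc[OF I] by (rule times_left_commute)
    then show ?case
      using step(3) power_times_Suc[OF I, of "Suc n"] by simp
  qed (rule m)
  obtain n0 where n0: "\<And>n c. n \<ge> n0 \<Longrightarrow> (\<forall>x\<in>?N (Suc n). scale c x = 0) \<Longrightarrow> (\<forall>x\<in>?N n. scale c x = 0)"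
    using annihilator_stabilises[OF I] by blast
  \<comment> \<open>Beyond \<open>m\<close> the reduction \<open>J0\<close> is effective and beyond
    \<open>n0\<close> the annihilators are constant; the summand \<open>2\<close> makes
    \<open>n\<close> the successor of a positive number, as \<open>rho_lower_bound\<close>
    requires.\<close>
  define s where "s = 2 + max m n0"
  define D where "D n = max_gen_degree scale R M (?N n)" for n
  define \<sigma> where "\<sigma> n = reduction_number scale R M (?N n)" for n
  note D_props = max_gen_degree_props[OF N d e nonzero_powers, folded D_def]
  have D_le: "D n \<le> l" if "generated_upto (?N n) l" for n l
    using max_gen_degree_props(2)[OF N d that nonzero_powers] by (simp add: D_def)
  have red_iff: "linear_reduction scale R M (?N n) J \<longleftrightarrow> linear_ideal J \<and> (\<exists>l. reduced_above (?N n) J l)" for n J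
    by (rule linear_reduction_iff[OF graded_subspace[OF N]])
  have step_above: "reduced_above (?N (Suc n)) J (r + l)" if "n \<ge> s" "reduced_above (?N n) J l" for n J l
    using reduced_above_times[OF gJ0 N that(2)] J0N[of n] that(1) by (simp add: s_def)
  \<comment> \<open>Going down uses the equality of annihilators, going up the degree bound
    \<open>step_above\<close>.\<close>
  have lin_Suc: "linear_reduction scale R M (?N (Suc n)) J \<longleftrightarrow> linear_reduction scale R M (?N n) J"
    if "n \<ge> s" for n J
  proof
    assume J: "linear_reduction scale R M (?N (Suc n)) J"
    obtain X where X: "finite X" "?N (Suc n) = span X"
      using finitely_generated_power_times[OF I] by blast
    show "linear_reduction scale R M (?N n) J"
      by (rule linear_reduction_transfer[OF N e d N X n0 Y J]) (use that in \<open>auto simp: s_def\<close>)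
  next
    assume "linear_reduction scale R M (?N n) J"
    then show "linear_reduction scale R M (?N (Suc n)) J"
      using step_above[OF that] red_iff by blast
  qed
  have min_Suc: "minimal_linear_reduction scale R M (?N (Suc n)) J \<longleftrightarrow> minimal_linear_reduction scale R M (?N n) J"
    if "n \<ge> s" for n J
    unfolding minimal_linear_reduction_def lin_Suc[OF that] ..
  have D_Suc: "D (Suc n) \<le> D n + r" if "n \<ge> s" for n
  proof -
    have "J0 \<odot> ?N n = ?N (Suc n)"
      using J0N that by (simp add: s_def)
    then show ?thesis
      using D_le[of "Suc n" "r + D n"] generated_upto_times[OF gJ0 N D_props(1), of n] by simp
  qed
  have D_lower: "d \<le> D n - r * int n" if "n \<ge> s" for n
  proof -
    have "n = Suc (n - 1)" "n - 1 > 0"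
      using that by (simp_all add: s_def)
    then obtain k where k: "n = Suc k" "k > 0"
      by blast
    then show ?thesis
      using rho_lower_bound[OF d k(2) D_props(1)[of n, unfolded k(1)]] by (simp add: r_def)
  qed
  have D_le_\<sigma>: "D n \<le> \<sigma> n" for n
  proof -
    obtain J where "minimal_linear_reduction scale R M (?N n) J" "\<sigma> n = reduction_number_wrt scale M (?N n) J"
      using reduction_number_props(1)[OF N e nonzero_powers d Y] by (auto simp: \<sigma>_def)
    then show ?thesis
      using reduction_number_wrt_props(3)[OF N nonzero_powers d e]
      by (simp add: D_def minimal_linear_reduction_def)
  qed
  \<comment> \<open>A minimal reduction \<open>J\<close> attaining \<open>r\<close> for
    \<open>?N n\<close> is also minimal for \<open>?N (Suc n)\<close>, so it competes in the minimum
    there.\<close>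
  have \<sigma>_Suc: "\<sigma> (Suc n) \<le> \<sigma> n + r" if "n \<ge> s" for n
  proof -
    obtain J where J: "minimal_linear_reduction scale R M (?N n) J" "\<sigma> n = reduction_number_wrt scale M (?N n) J"
      using reduction_number_props(1)[OF N e nonzero_powers d Y] by (auto simp: \<sigma>_def)
    then have lin: "linear_reduction scale R M (?N n) J"
      by (simp add: minimal_linear_reduction_def)
    have "\<sigma> (Suc n) \<le> reduction_number_wrt scale M (?N (Suc n)) J"
      unfolding \<sigma>_def using reduction_number_props(2)[OF N e nonzero_powers d Y] min_Suc[OF that] J(1)
      by blast
    also have "\<dots> \<le> r + reduction_number_wrt scale M (?N n) J"
      using reduction_number_wrt_props(1)[OF N nonzero_powers d e lin] lin lin_Suc[OF that]
      by (intro reduction_number_wrt_props(2)[OF N nonzero_powers d e] step_above[OF that]) blast+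
    finally show ?thesis
      using J(2) by simp
  qed
  obtain \<epsilon>\<^sub>2 n2 where \<epsilon>\<^sub>2: "\<And>n. n \<ge> n2 \<Longrightarrow> D n - r * int n = \<epsilon>\<^sub>2" "n2 \<ge> s"
  proof (rule antimono_int_eventually_constant[of s "\<lambda>n. D n - r * int n" d])
    show "D (Suc n) - r * int (Suc n) \<le> D n - r * int n" if "n \<ge> s" for n
      using D_Suc[OF that] by (simp add: distrib_left)
  qed (use D_lower in auto)
  obtain \<epsilon>\<^sub>1 n1 where \<epsilon>\<^sub>1: "\<And>n. n \<ge> n1 \<Longrightarrow> \<sigma> n - r * int n = \<epsilon>\<^sub>1" "n1 \<ge> s"
  proof (rule antimono_int_eventually_constant[of s "\<lambda>n. \<sigma> n - r * int n" d])
    show "\<sigma> (Suc n) - r * int (Suc n) \<le> \<sigma> n - r * int n" if "n \<ge> s" for n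
      using \<sigma>_Suc[OF that] by (simp add: distrib_left)
    show "d \<le> \<sigma> n - r * int n" if "n \<ge> s" for n
      \<comment> \<open>The lower bound for \<open>r\<close> is inherited from
        \<open>D\<close>.\<close>
      using D_lower[OF that] D_le_\<sigma>[of n] by simp
  qed auto
  have "\<epsilon>\<^sub>1 \<ge> \<epsilon>\<^sub>2"
    using \<epsilon>\<^sub>1(1)[of "max n1 n2"] \<epsilon>\<^sub>2(1)[of "max n1 n2"] D_le_\<sigma>[of "max n1 n2"] by simp
  moreover have "\<epsilon>\<^sub>2 \<ge> d"
    using \<epsilon>\<^sub>2(1)[of n2] D_lower[OF \<epsilon>\<^sub>2(2)] by simp
  moreover have "\<forall>\<^sub>F n in sequentially. \<sigma> n = r * int n + \<epsilon>\<^sub>1 \<and> D n = r * int n + \<epsilon>\<^sub>2"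
    using \<epsilon>\<^sub>1(1) \<epsilon>\<^sub>2(1) by (intro eventually_sequentiallyI[of "max n1 n2"]) fastforce
  ultimately show ?thesis
    unfolding d_def r_def \<sigma>_def D_def by blast
qed

end

end

theorem theorem1p2:
  fixes K :: "'a::comm_ring_1 set"
    and R :: "nat \<Rightarrow> 'a set"
    and scale :: "'a \<Rightarrow> 'm::ab_group_add \<Rightarrow> 'm"
    and M :: "int \<Rightarrow> 'm set"
    and I :: "'a set"
  defines "IM \<equiv> (\<lambda>n. ideal_module_prod scale (ideal_power I n) UNIV)"
  assumes "standard_graded_algebra K R"
    and "infinite K"
    and noetherian: "\<And>A :: 'a set. is_ideal A \<Longrightarrow> \<exists>B. finite B \<and> A = ideal_span B"
    and "graded_module scale R M"
    and finitely_generated: "\<exists>B. finite B \<and> module.span scale B = UNIV"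
    and nonzero: "(UNIV :: 'm set) \<noteq> {0}"
    and "graded_ideal R I"
  shows "\<exists>\<epsilon>\<^sub>1 \<epsilon>\<^sub>2 :: int. \<epsilon>\<^sub>1 \<ge> \<epsilon>\<^sub>2 \<and> \<epsilon>\<^sub>2 \<ge> min_degree M UNIV \<and>
    (\<forall>\<^sub>F n in sequentially. IM n \<noteq> {0} \<longrightarrow>
       reduction_number scale R M (IM n) = rho scale R I * int n + \<epsilon>\<^sub>1 \<and>
       max_gen_degree scale R M (IM n) = rho scale R I * int n + \<epsilon>\<^sub>2)"
proof -
  interpret noetherian_graded_module K R scale M
    using assms by (intro noetherian_graded_module.intro graded_algebra_module.intro
        noetherian_graded_module_axioms.intro) auto
  show ?thesis
  \<comment> \<open>Once one \<open>IM n\<close> is zero, so are all later ones.\<close>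
  proof (cases "\<forall>n. IM n \<noteq> {0}")
    case True
    then show ?thesis
      using asymptotic_linearity[OF assms(8)] unfolding IM_def by (auto elim: eventually_mono)
  next
    case False
    then obtain n0 where n0: "IM n0 = {0}"
      by blast
    have "IM n = {0}" if "n \<ge> n0" for n
      using that
    proof (induct n rule: dec_induct)
      case (step n)
      then show ?case
        using power_times_Suc_subset[OF assms(8), of n] subspace_0[OF subspace_times[of "ideal_power I (Suc n)" UNIV]]
        unfolding IM_def by auto
    qed (rule n0)
    then have "\<forall>\<^sub>F n in sequentially. IM n = {0}"
      by (rule eventually_sequentiallyI)
    then show ?thesis
      \<comment> \<open>The guarded claim is eventually vacuous, so both constants may be set to
        \<open>d(M)\<close>.\<close>
      by (intro exI[of _ "min_degree M UNIV"]) (auto elim: eventually_mono)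
  qed
qed

end
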